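(* Let $S$ be a finite $p$-group for an odd prime $p$. Then $J(S)\leq \mathfrak{X}(S)$ if and only if $\mathfrak{X}(L)=\mathfrak{X}(S)$ for every subgroup $L$ of $S$ with $\mathfrak{X}(S)\leq L\leq J(S)\mathfrak{X}(S)$.
   Context: For a finite $p$-group $G$ and subgroups $A,B$, write $[A,B;1]=[A,B]$ and $[A,B;k]=[[A,B;k-1],B]$. $\Omega_1(G)$ denotes the subgroup generated by the elements of order $p$ in $G$. The Oliver subgroup $\mathfrak{X}(G)$ of a finite $p$-group $G$ is the unique largest normal subgroup $K$ of $G$ admitting a chain $1=Q_0\leq Q_1\leq\cdots\leq Q_n=K$ of normal subgroups $Q_i\unlhd G$ such that $[\Omega_1(C_G(Q_{i-1})),Q_i;p-1]=1$ for each $1\leq i\leq n$. For a subgroup $L\leq S$, $\mathfrak{X}(L)$ is the Oliver subgroup of $L$ regarded as a $p$-group in its own right. $J(S)$ is the Thompson subgroup of $S$: the subgroup generated by all elementary abelian $p$-subgroups of $S$ whose rank equals the $p$-rank of $S$ (the largest rank of an elementary abelian $p$-subgroup of $S$). *)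

theory Defs
  imports "HOL-Algebra.Algebra" "HOL-Computational_Algebra.Primes"
begin

definition commutator_subgroup :: "('a, 'b) monoid_scheme \<Rightarrow> 'a set \<Rightarrow> 'a set \<Rightarrow> 'a set" where
  "commutator_subgroup G A B =
     generate G (\<Union>a \<in> A. \<Union>b \<in> B. {a \<otimes>\<^bsub>G\<^esub> b \<otimes>\<^bsub>G\<^esub> inv\<^bsub>G\<^esub> a \<otimes>\<^bsub>G\<^esub> inv\<^bsub>G\<^esub> b})"

fun comm_iter :: "('a, 'b) monoid_scheme \<Rightarrow> 'a set \<Rightarrow> 'a set \<Rightarrow> nat \<Rightarrow> 'a set" where
  "comm_iter G A B 0 = A"
| "comm_iter G A B (Suc k) = commutator_subgroup G (comm_iter G A B k) B"

definition centralizer :: "('a, 'b) monoid_scheme \<Rightarrow> 'a set \<Rightarrow> 'a set" where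
  "centralizer G Q = {g \<in> carrier G. \<forall>q \<in> Q. g \<otimes>\<^bsub>G\<^esub> q = q \<otimes>\<^bsub>G\<^esub> g}"

definition Omega1 :: "('a, 'b) monoid_scheme \<Rightarrow> nat \<Rightarrow> 'a set \<Rightarrow> 'a set" where
  "Omega1 G p H = generate G {x \<in> H. group.ord G x = p}"

definition oliver_chain :: "('a, 'b) monoid_scheme \<Rightarrow> nat \<Rightarrow> 'a set \<Rightarrow> bool" where
  "oliver_chain G p K \<longleftrightarrow>
     (\<exists>(n::nat) (Q :: nat \<Rightarrow> 'a set).
        Q 0 = {\<one>\<^bsub>G\<^esub>} \<and> Q n = K \<and>
        (\<forall>i \<le> n. Q i \<lhd> G) \<and>
        (\<forall>i < n. Q i \<subseteq> Q (Suc i)) \<and>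
        (\<forall>i. 1 \<le> i \<and> i \<le> n \<longrightarrow>
           comm_iter G (Omega1 G p (centralizer G (Q (i - 1)))) (Q i) (p - 1) = {\<one>\<^bsub>G\<^esub>}))"

definition oliver_subgroup :: "('a, 'b) monoid_scheme \<Rightarrow> nat \<Rightarrow> 'a set" where
  "oliver_subgroup G p =
     (THE K. K \<lhd> G \<and> oliver_chain G p K \<and> (\<forall>K'. K' \<lhd> G \<and> oliver_chain G p K' \<longrightarrow> K' \<subseteq> K))"

definition elementary_abelian :: "('a, 'b) monoid_scheme \<Rightarrow> nat \<Rightarrow> 'a set \<Rightarrow> bool" where
  "elementary_abelian G p E \<longleftrightarrow>
     subgroup E G \<and>
     (\<forall>x \<in> E. \<forall>y \<in> E. x \<otimes>\<^bsub>G\<^esub> y = y \<otimes>\<^bsub>G\<^esub> x) \<and>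
     (\<forall>x \<in> E. x [^]\<^bsub>G\<^esub> p = \<one>\<^bsub>G\<^esub>)"

text \<open>The rank of an elementary abelian p-group E (of order p^r) is r.\<close>
definition el_rank :: "nat \<Rightarrow> 'a set \<Rightarrow> nat" where
  "el_rank p E = Factorial_Ring.multiplicity p (card E)"

definition p_rank :: "('a, 'b) monoid_scheme \<Rightarrow> nat \<Rightarrow> nat" where
  "p_rank G p = Max {el_rank p E | E. elementary_abelian G p E}"

definition thompson_subgroup :: "('a, 'b) monoid_scheme \<Rightarrow> nat \<Rightarrow> 'a set" where
  "thompson_subgroup G p =
     generate G (\<Union>{E. elementary_abelian G p E \<and> el_rank p E = p_rank G p})"

definition p_group :: "('a, 'b) monoid_scheme \<Rightarrow> nat \<Rightarrow> bool" where
  "p_group G p \<longleftrightarrow> group G \<and> finite (carrier G) \<and> Factorial_Ring.prime p \<and> (\<exists>n. order G = p ^ n)"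

end

theory Submission
  imports Defs
begin

text \<open>Write \<open>\<XX> = \<XX>(S)\<close> and \<open>V = \<Omega>\<^sub>1(C\<^sub>S(\<XX>))\<close>. Maximality of \<open>\<XX>\<close> forces
  \<open>C\<^sub>S(\<XX>) \<le> \<XX>\<close>, so that \<open>V\<close> is elementary abelian, and \<open>\<XX> = C\<^sub>S(V)\<close>. If
  \<open>J(S)\<close> is not contained in \<open>\<XX>\<close>, choose an elementary abelian subgroup \<open>A\<close> of maximal rank
  not contained in \<open>\<XX>\<close> with \<open>|A \<inter> V|\<close> as large as possible. Thompson replacement shows that
  \<open>A\<close> acts quadratically on \<open>V\<close>, so that \<open>[V, A \<XX>; p - 1] = 1\<close> as \<open>p\<close> is odd. Hence \<open>L = A \<XX>\<close>
  is its own Oliver subgroup and properly contains \<open>\<XX>\<close>. Conversely, if \<open>J(S) \<le> \<XX>\<close> then only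
  \<open>L = \<XX>\<close> has to be considered, and a chain for \<open>\<XX>\<close> in \<open>S\<close> is also one in \<open>\<XX>\<close>.\<close>

section \<open>Commutators, centralizers and products of subgroups\<close>

context group
begin

lemma inv_mult_cancel:
  assumes "x \<in> carrier G" "y \<in> carrier G"
  shows "inv x \<otimes> (x \<otimes> y) = y" "x \<otimes> (inv x \<otimes> y) = y"
  using assms by (simp_all add: m_assoc [symmetric])

lemmas group_cancel = m_assoc inv_mult_group inv_mult_cancel

lemma commutator_eq_one_iff:
  assumes "a \<in> carrier G" "b \<in> carrier G"
  shows "a \<otimes> b \<otimes> inv a \<otimes> inv b = \<one> \<longleftrightarrow> a \<otimes> b = b \<otimes> a"
proof -
  have "a \<otimes> b \<otimes> inv a \<otimes> inv b = (a \<otimes> b) \<otimes> inv (b \<otimes> a)"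
    using assms by (simp add: group_cancel)
  then show ?thesis
    using assms by (metis inv_solve_right' l_one m_closed one_closed)
qed

lemma commutator_subgroup_subset:
  assumes "subgroup H G" "\<And>a b. a \<in> A \<Longrightarrow> b \<in> B \<Longrightarrow> a \<otimes> b \<otimes> inv a \<otimes> inv b \<in> H"
  shows "commutator_subgroup G A B \<subseteq> H"
  unfolding commutator_subgroup_def using assms by (intro generate_subgroup_incl) auto

lemma commutator_subgroup_mono:
  "A \<subseteq> A' \<Longrightarrow> B \<subseteq> B' \<Longrightarrow> commutator_subgroup G A B \<subseteq> commutator_subgroup G A' B'"
  unfolding commutator_subgroup_def by (intro mono_generate) blast

lemma commutator_subgroup_is_subgroup:
  assumes "A \<subseteq> carrier G" "B \<subseteq> carrier G"
  shows "subgroup (commutator_subgroup G A B) G"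
  unfolding commutator_subgroup_def using assms by (intro generate_is_subgroup) (auto simp: subset_iff)

lemma commutator_in_commutator_subgroup:
  "a \<in> A \<Longrightarrow> b \<in> B \<Longrightarrow> a \<otimes> b \<otimes> inv a \<otimes> inv b \<in> commutator_subgroup G A B"
  unfolding commutator_subgroup_def by (rule generate.incl) blast

lemma comm_iter_mono:
  "A \<subseteq> A' \<Longrightarrow> B \<subseteq> B' \<Longrightarrow> comm_iter G A B k \<subseteq> comm_iter G A' B' k"
  by (induction k) (simp_all add: commutator_subgroup_mono)

text \<open>Turns an inclusion of an iterated commutator in the trivial group into the equality that
  the chain condition asks for.\<close>

lemma one_in_comm_iter:
  "\<one> \<in> A \<Longrightarrow> \<one> \<in> comm_iter G A B k"
  by (cases k) (auto simp: commutator_subgroup_def intro: generate.one)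

lemma commutator_subgroup_one:
  assumes "B \<subseteq> carrier G"
  shows "commutator_subgroup G {\<one>} B = {\<one>}"
proof -
  have "commutator_subgroup G {\<one>} B \<subseteq> {\<one>}"
    using assms by (intro commutator_subgroup_subset triv_subgroup) auto
  then show ?thesis
    by (auto simp: commutator_subgroup_def intro: generate.one)
qed

text \<open>A trivial group stays trivial under further commutation, so vanishing after one or two
  steps gives vanishing at the exponent \<open>p - 1\<close> of the chain condition.\<close>

lemma comm_iter_trivial_mono:
  assumes "B \<subseteq> carrier G" "comm_iter G A B j = {\<one>}" "j \<le> k"
  shows "comm_iter G A B k = {\<one>}"
  using assms(3) by (induction k rule: dec_induct) (simp_all add: assms commutator_subgroup_one)

section \<open>Centralizers and the subgroup generated by elements of order \<open>p\<close>\<close>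

lemma centralizer_is_subgroup:
  assumes "Q \<subseteq> carrier G"
  shows "subgroup (centralizer G Q) G"
proof (rule subgroupI)
  show "centralizer G Q \<noteq> {}" using assms by (auto simp: centralizer_def intro!: exI [of _ \<one>])
next
  fix a assume a: "a \<in> centralizer G Q"
  have "inv a \<otimes> q = q \<otimes> inv a" if "q \<in> Q" for q
  proof -
    have "a \<otimes> q = q \<otimes> a" "a \<in> carrier G" "q \<in> carrier G"
      using a that assms by (auto simp: centralizer_def)
    then show ?thesis
      by (metis inv_closed inv_solve_left inv_solve_right' m_assoc m_closed)
  qed
  then show "inv a \<in> centralizer G Q" using a by (simp add: centralizer_def)
next
  fix a b assume ab: "a \<in> centralizer G Q" "b \<in> centralizer G Q"
  have "a \<otimes> b \<otimes> q = q \<otimes> (a \<otimes> b)" if "q \<in> Q" for q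
  proof -
    have "q \<in> carrier G" using that assms by blast
    then show ?thesis using ab that unfolding centralizer_def
      by (smt (verit) m_assoc mem_Collect_eq)
  qed
  then show "a \<otimes> b \<in> centralizer G Q" using ab by (simp add: centralizer_def)
qed (auto simp: centralizer_def)

lemma centralizer_is_normal:
  assumes "Q \<lhd> G"
  shows "centralizer G Q \<lhd> G"
proof (rule normal_invI)
  have Q: "Q \<subseteq> carrier G" by (simp add: assms normal_imp_subgroup subgroup.subset)
  then show "subgroup (centralizer G Q) G" by (rule centralizer_is_subgroup)
  fix x h assume x: "x \<in> carrier G" and h: "h \<in> centralizer G Q"
  have "x \<otimes> h \<otimes> inv x \<otimes> q = q \<otimes> (x \<otimes> h \<otimes> inv x)" if q: "q \<in> Q" for q
  proof -
    have c: "h \<in> carrier G" "q \<in> carrier G" using h q Q by (auto simp: centralizer_def)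
    have "h \<otimes> (inv x \<otimes> q \<otimes> x) = (inv x \<otimes> q \<otimes> x) \<otimes> h"
      using h normal.inv_op_closed1 [OF assms x q] by (simp add: centralizer_def)
    then have "x \<otimes> (h \<otimes> (inv x \<otimes> q \<otimes> x)) \<otimes> inv x = x \<otimes> ((inv x \<otimes> q \<otimes> x) \<otimes> h) \<otimes> inv x"
      by simp
    then show ?thesis using x c by (simp add: group_cancel)
  qed
  then show "x \<otimes> h \<otimes> inv x \<in> centralizer G Q"
    using x h by (simp add: centralizer_def)
qed

lemma centralizer_antimono:
  "Q \<subseteq> R \<Longrightarrow> centralizer G R \<subseteq> centralizer G Q"
  by (auto simp: centralizer_def)

lemma Omega1_mono:
  "H \<subseteq> K \<Longrightarrow> Omega1 G p H \<subseteq> Omega1 G p K"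
  unfolding Omega1_def by (rule mono_generate) blast

lemma Omega1_subset:
  "subgroup H G \<Longrightarrow> Omega1 G p H \<subseteq> H"
  unfolding Omega1_def by (rule generate_subgroup_incl) auto

lemma one_in_Omega1: "\<one> \<in> Omega1 G p H"
  unfolding Omega1_def by (rule generate.one)

lemma ord_conjugate:
  assumes "x \<in> carrier G" "g \<in> carrier G"
  shows "ord (g \<otimes> x \<otimes> inv g) = ord x"
proof -
  have pow: "(g \<otimes> x \<otimes> inv g) [^] n = g \<otimes> x [^] n \<otimes> inv g" for n :: nat
    using assms by (induction n) (simp_all add: group_cancel)
  have "g \<otimes> y \<otimes> inv g = \<one> \<longleftrightarrow> y = \<one>" if "y \<in> carrier G" for y
  proof
    assume "g \<otimes> y \<otimes> inv g = \<one>"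
    then have "inv g \<otimes> (g \<otimes> y \<otimes> inv g) \<otimes> g = inv g \<otimes> \<one> \<otimes> g" by simp
    then show "y = \<one>" using assms that by (simp add: group_cancel)
  qed (use assms in simp)
  then show ?thesis
    using assms by (subst ord_unique) (simp_all add: pow pow_eq_id)
qed

lemma Omega1_is_normal:
  assumes "H \<lhd> G"
  shows "Omega1 G p H \<lhd> G"
  unfolding Omega1_def
proof (rule normal_generateI)
  have H: "H \<subseteq> carrier G" by (simp add: assms normal_imp_subgroup subgroup.subset)
  then show "{x \<in> H. ord x = p} \<subseteq> carrier G" by blast
  fix h g assume "h \<in> {x \<in> H. ord x = p}" "g \<in> carrier G"
  then show "g \<otimes> h \<otimes> inv g \<in> {x \<in> H. ord x = p}"
    using H normal.inv_op_closed2 [OF assms] by (auto simp: ord_conjugate)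
qed

section \<open>Products with normal subgroups and their commutators\<close>

lemma subset_set_mult_left:
  "K \<subseteq> carrier G \<Longrightarrow> \<one> \<in> H \<Longrightarrow> K \<subseteq> K <#> H"
  unfolding set_mult_def by force

lemma subset_set_mult_right:
  "H \<subseteq> carrier G \<Longrightarrow> \<one> \<in> K \<Longrightarrow> H \<subseteq> K <#> H"
  unfolding set_mult_def by force

lemma subgroup_set_mult_normal:
  assumes "subgroup H G" "N \<lhd> G"
  shows "subgroup (H <#> N) G"
  using assms commut_normal mult_norm_subgroup by metis

lemma normal_set_mult:
  assumes K: "K \<lhd> G" and R: "R \<lhd> G"
  shows "K <#> R \<lhd> G"
proof (rule normal_invI)
  show "subgroup (K <#> R) G"
    using assms by (intro subgroup_set_mult_normal normal_imp_subgroup)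
  fix x h assume x: "x \<in> carrier G" and "h \<in> K <#> R"
  then obtain k r where kr: "k \<in> K" "r \<in> R" "h = k \<otimes> r" by (auto simp: set_mult_def)
  have c: "k \<in> carrier G" "r \<in> carrier G"
    using kr K R by (meson normal_imp_subgroup subgroup.mem_carrier)+
  have "x \<otimes> h \<otimes> inv x = (x \<otimes> k \<otimes> inv x) \<otimes> (x \<otimes> r \<otimes> inv x)"
    using x c kr by (simp add: group_cancel)
  then show "x \<otimes> h \<otimes> inv x \<in> K <#> R"
    using normal.inv_op_closed2 [OF K x kr(1)] normal.inv_op_closed2 [OF R x kr(2)]
    by (auto simp: set_mult_def)
qed

text \<open>If \<open>a\<close> centralizes \<open>K\<close>, then its commutator with
  \<open>k \<otimes> r\<close> is the conjugate by \<open>k\<close> of its commutator with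
  \<open>r\<close>. The latter lies in the normal subgroup \<open>centralizer G K\<close>, so this
  conjugation changes nothing. The second conjunct keeps the assumption on \<open>a\<close> alive
  through the induction.\<close>

lemma comm_iter_set_mult_centralized:
  assumes K: "K \<lhd> G" and R: "R \<lhd> G" and A: "A \<subseteq> centralizer G K"
  shows "comm_iter G A (K <#> R) j \<subseteq> comm_iter G A R j \<and> comm_iter G A R j \<subseteq> centralizer G K"
proof (induction j)
  case 0
  show ?case using A by simp
next
  case (Suc j)
  let ?A = "comm_iter G A R j"
  have CK: "centralizer G K \<lhd> G" by (rule centralizer_is_normal [OF K])
  have CKs: "subgroup (centralizer G K) G" by (rule normal_imp_subgroup [OF CK])
  have Rc: "R \<subseteq> carrier G" and Kc: "K \<subseteq> carrier G"
    using K R by (auto dest!: normal_imp_subgroup subgroup.subset)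
  have AC: "?A \<subseteq> centralizer G K" using Suc by blast
  then have Ac: "?A \<subseteq> carrier G" using subgroup.subset [OF CKs] by blast
  have comm: "a \<otimes> r \<otimes> inv a \<otimes> inv r \<in> centralizer G K" if "a \<in> ?A" "r \<in> R" for a r
  proof -
    have a: "a \<in> centralizer G K" "inv a \<in> centralizer G K"
      using AC that subgroup.m_inv_closed [OF CKs] by auto
    have "r \<otimes> inv a \<otimes> inv r \<in> centralizer G K"
      using normal.inv_op_closed2 [OF CK _ a(2)] Rc that by blast
    then have "a \<otimes> (r \<otimes> inv a \<otimes> inv r) \<in> centralizer G K"
      using a subgroup.m_closed [OF CKs] by blast
    then show ?thesis using that Ac Rc by (simp add: m_assoc subset_iff)
  qed
  have 1: "commutator_subgroup G ?A R \<subseteq> centralizer G K"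
    by (rule commutator_subgroup_subset [OF CKs comm])
  have "commutator_subgroup G (comm_iter G A (K <#> R) j) (K <#> R) \<subseteq> commutator_subgroup G ?A R"
  proof (rule commutator_subgroup_subset)
    show "subgroup (commutator_subgroup G ?A R) G"
      by (rule commutator_subgroup_is_subgroup [OF Ac Rc])
    fix a b assume "a \<in> comm_iter G A (K <#> R) j" "b \<in> K <#> R"
    then obtain k r where a: "a \<in> ?A" and k: "k \<in> K" and r: "r \<in> R" and b: "b = k \<otimes> r"
      using Suc by (auto simp: set_mult_def)
    have c: "a \<in> carrier G" "k \<in> carrier G" "r \<in> carrier G" using a k r Ac Kc Rc by auto
    have ak: "a \<otimes> k = k \<otimes> a" using a k AC by (auto simp: centralizer_def)
    have "a \<otimes> b \<otimes> inv a \<otimes> inv b = (a \<otimes> k) \<otimes> r \<otimes> inv a \<otimes> inv r \<otimes> inv k"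
      using c b by (simp add: group_cancel)
    also have "\<dots> = k \<otimes> (a \<otimes> r \<otimes> inv a \<otimes> inv r) \<otimes> inv k"
      unfolding ak using c by (simp add: m_assoc)
    also have "\<dots> = (a \<otimes> r \<otimes> inv a \<otimes> inv r) \<otimes> k \<otimes> inv k"
      using comm [OF a r] k by (simp add: centralizer_def)
    also have "\<dots> = a \<otimes> r \<otimes> inv a \<otimes> inv r"
      using c by (simp add: m_assoc)
    finally show "a \<otimes> b \<otimes> inv a \<otimes> inv b \<in> commutator_subgroup G ?A R"
      using commutator_in_commutator_subgroup [OF a r] by simp
  qed
  with 1 show ?case by simp
qed

subsection \<open>Passing to a subgroup\<close>

lemma commutator_subgroup_consistent:
  assumes "subgroup L G" "A \<subseteq> L" "B \<subseteq> L"
  shows "commutator_subgroup (G\<lparr>carrier := L\<rparr>) A B = commutator_subgroup G A B"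
proof -
  have "(\<Union>a\<in>A. \<Union>b\<in>B. {a \<otimes> b \<otimes> inv\<^bsub>G\<lparr>carrier := L\<rparr>\<^esub> a \<otimes> inv\<^bsub>G\<lparr>carrier := L\<rparr>\<^esub> b})
      = (\<Union>a\<in>A. \<Union>b\<in>B. {a \<otimes> b \<otimes> inv a \<otimes> inv b})"
    using assms by (auto simp: m_inv_consistent subset_iff)
  moreover have "(\<Union>a\<in>A. \<Union>b\<in>B. {a \<otimes> b \<otimes> inv a \<otimes> inv b}) \<subseteq> L"
    using assms by (auto simp: subset_iff subgroup.m_closed subgroup.m_inv_closed)
  ultimately show ?thesis
    unfolding commutator_subgroup_def using assms by (simp add: generate_consistent)
qed

lemma commutator_subgroup_subset_subgroup:
  assumes "subgroup L G" "A \<subseteq> L" "B \<subseteq> L"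
  shows "commutator_subgroup G A B \<subseteq> L"
  using assms by (intro commutator_subgroup_subset) (auto simp: subset_iff subgroup.m_closed subgroup.m_inv_closed)

lemma comm_iter_consistent:
  assumes L: "subgroup L G" and A: "A \<subseteq> L" and B: "B \<subseteq> L"
  shows "comm_iter (G\<lparr>carrier := L\<rparr>) A B k = comm_iter G A B k"
proof -
  have "comm_iter G A B k \<subseteq> L" for k
    by (induction k) (simp_all add: A B commutator_subgroup_subset_subgroup [OF L])
  then show ?thesis
    by (induction k) (simp_all add: B commutator_subgroup_consistent [OF L])
qed

lemma centralizer_consistent:
  "L \<subseteq> carrier G \<Longrightarrow> centralizer (G\<lparr>carrier := L\<rparr>) Q = centralizer G Q \<inter> L"
  by (auto simp: centralizer_def)

lemma Omega1_consistent:
  assumes L: "subgroup L G" and H: "H \<subseteq> L"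
  shows "Omega1 (G\<lparr>carrier := L\<rparr>) p H = Omega1 G p H"
proof -
  have "group.ord (G\<lparr>carrier := L\<rparr>) x = ord x" for x
    using group.ord_def [OF subgroup_imp_group [OF L]]
    by (simp add: ord_def nat_pow_consistent [symmetric])
  then show ?thesis
    unfolding Omega1_def using H by (simp add: generate_consistent [OF _ L] subset_iff)
qed

text \<open>In \<open>L\<close> the centralizer shrinks to its intersection with \<open>L\<close>.
  As \<open>Omega1\<close> and iterated commutators are monotone, the chain condition survives the
  passage to \<open>L\<close>.\<close>

lemma comm_iter_Omega1_centralizer_consistent:
  assumes L: "subgroup L G" and R: "R \<subseteq> L"
    and triv: "comm_iter G (Omega1 G p (centralizer G Q)) R k = {\<one>}"
  shows "comm_iter (G\<lparr>carrier := L\<rparr>) (Omega1 (G\<lparr>carrier := L\<rparr>) p (centralizer (G\<lparr>carrier := L\<rparr>) Q)) R k = {\<one>}"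
proof -
  let ?W = "Omega1 G p (centralizer G Q \<inter> L)"
  have W: "Omega1 (G\<lparr>carrier := L\<rparr>) p (centralizer (G\<lparr>carrier := L\<rparr>) Q) = ?W"
    using L by (simp add: centralizer_consistent subgroup.subset Omega1_consistent)
  have WL: "?W \<subseteq> L"
    unfolding Omega1_def using L by (intro generate_subgroup_incl) auto
  have "comm_iter G ?W R k \<subseteq> comm_iter G (Omega1 G p (centralizer G Q)) R k"
    by (intro comm_iter_mono Omega1_mono) auto
  with triv have "comm_iter G ?W R k = {\<one>}"
    using one_in_comm_iter [OF one_in_Omega1] by auto
  then show ?thesis unfolding W using comm_iter_consistent [OF L WL R] by simp
qed

end

section \<open>The Oliver subgroup\<close>

context group
begin

lemma oliver_chain_one: "oliver_chain G p {\<one>}"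
  unfolding oliver_chain_def
  by (rule exI [of _ 0], rule exI [of _ "\<lambda>_. {\<one>}"]) (simp add: one_is_normal)

lemma oliver_chain_normal: "oliver_chain G p K \<Longrightarrow> K \<lhd> G"
  unfolding oliver_chain_def by blast

lemma oliver_chain_extend:
  assumes K: "oliver_chain G p K" and R: "R \<lhd> G" "K \<subseteq> R"
    and comm: "comm_iter G (Omega1 G p (centralizer G K)) R (p - 1) = {\<one>}"
  shows "oliver_chain G p R"
proof -
  obtain n Q where Q: "Q 0 = {\<one>}" "Q n = K" "\<And>i. i \<le> n \<Longrightarrow> Q i \<lhd> G"
      "\<And>i. i < n \<Longrightarrow> Q i \<subseteq> Q (Suc i)"
      "\<And>i. 1 \<le> i \<Longrightarrow> i \<le> n \<Longrightarrow>
         comm_iter G (Omega1 G p (centralizer G (Q (i - 1)))) (Q i) (p - 1) = {\<one>}"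
    using K unfolding oliver_chain_def by metis
  let ?Q = "Q(Suc n := R)"
  have normal: "?Q i \<lhd> G" if "i \<le> Suc n" for i
    using Q(3) R(1) that by (cases "i = Suc n") auto
  have incl: "?Q i \<subseteq> ?Q (Suc i)" if "i < Suc n" for i
    using Q(2,4) R(2) that by (cases "i = n") auto
  have triv: "comm_iter G (Omega1 G p (centralizer G (?Q (i - 1)))) (?Q i) (p - 1) = {\<one>}"
    if "1 \<le> i" "i \<le> Suc n" for i
  proof (cases "i = Suc n")
    case True
    then show ?thesis using Q(2) comm by simp
  next
    case False
    then have "i \<noteq> Suc n" "i - 1 \<noteq> Suc n" "i \<le> n" using that by auto
    then show ?thesis using Q(5) that by simp
  qed
  show ?thesis
    unfolding oliver_chain_def
    by (rule exI [of _ "Suc n"], rule exI [of _ ?Q]) (use Q(1) normal incl triv in auto)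
qed

text \<open>Each term of a chain is itself the end of a chain. This allows induction over chain ends
  without indices, and the step may assume that \<open>Q\<close> is such an end.\<close>

lemma oliver_chain_induct [consumes 1, case_names one extend]:
  assumes "oliver_chain G p K" and one: "P {\<one>}"
    and extend: "\<And>Q R. oliver_chain G p Q \<Longrightarrow> R \<lhd> G \<Longrightarrow> Q \<subseteq> R \<Longrightarrow>
      comm_iter G (Omega1 G p (centralizer G Q)) R (p - 1) = {\<one>} \<Longrightarrow> P Q \<Longrightarrow> P R"
  shows "P K"
proof -
  obtain n Q where Q: "Q 0 = {\<one>}" "Q n = K" "\<And>i. i \<le> n \<Longrightarrow> Q i \<lhd> G"
      "\<And>i. i < n \<Longrightarrow> Q i \<subseteq> Q (Suc i)"
      "\<And>i. 1 \<le> i \<Longrightarrow> i \<le> n \<Longrightarrow>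
         comm_iter G (Omega1 G p (centralizer G (Q (i - 1)))) (Q i) (p - 1) = {\<one>}"
    using assms(1) unfolding oliver_chain_def by metis
  have "oliver_chain G p (Q i) \<and> P (Q i)" if "i \<le> n" for i
    using that
  proof (induction i)
    case 0
    show ?case by (simp add: Q(1) oliver_chain_one one)
  next
    case (Suc i)
    have step: "Q (Suc i) \<lhd> G" "Q i \<subseteq> Q (Suc i)"
        "comm_iter G (Omega1 G p (centralizer G (Q i))) (Q (Suc i)) (p - 1) = {\<one>}"
      using Suc.prems Q(3,4) Q(5) [of "Suc i"] by auto
    have "oliver_chain G p (Q i)" "P (Q i)" using Suc by auto
    then show ?case using step oliver_chain_extend extend by blast
  qed
  then show ?thesis using Q(2) by blast
qed

text \<open>A group centralizing \<open>K\<close> has the same iterated commutators with \<open>K R\<close> as with \<open>R\<close>,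
  so multiplying a chain by \<open>K\<close> prolongs a chain that ends in \<open>K\<close>.\<close>

lemma oliver_chain_set_mult:
  assumes K: "oliver_chain G p K" and "oliver_chain G p K'"
  shows "oliver_chain G p (K <#> K')"
  using assms(2)
proof (induction rule: oliver_chain_induct)
  case one
  have "K \<subseteq> carrier G" using K by (meson oliver_chain_normal normal_imp_subgroup subgroup.subset)
  then have "K <#> {\<one>} = K" unfolding set_mult_def by force
  then show ?case using K by simp
next
  case (extend Q R)
  have Kn: "K \<lhd> G" using K by (rule oliver_chain_normal)
  have Qn: "Q \<lhd> G" using extend(1) by (rule oliver_chain_normal)
  have sub: "K \<subseteq> carrier G" "Q \<subseteq> carrier G" "\<one> \<in> K" "\<one> \<in> Q"
    using Kn Qn by (auto dest!: normal_imp_subgroup intro: subgroup.one_closed dest: subgroup.subset)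
  have KQ: "K \<subseteq> K <#> Q" "Q \<subseteq> K <#> Q"
    using sub by (simp_all add: subset_set_mult_left subset_set_mult_right)
  let ?A = "Omega1 G p (centralizer G (K <#> Q))"
  have "K <#> Q \<lhd> G" using Kn Qn by (rule normal_set_mult)
  then have "subgroup (centralizer G (K <#> Q)) G"
    by (intro normal_imp_subgroup centralizer_is_normal)
  then have AC: "?A \<subseteq> centralizer G K"
    using Omega1_subset centralizer_antimono [OF KQ(1)] by blast
  have "comm_iter G ?A (K <#> R) (p - 1) \<subseteq> comm_iter G ?A R (p - 1)"
    using comm_iter_set_mult_centralized [OF Kn extend(2) AC] by blast
  also have "\<dots> \<subseteq> comm_iter G (Omega1 G p (centralizer G Q)) R (p - 1)"
    by (intro comm_iter_mono Omega1_mono centralizer_antimono KQ order_refl)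
  finally have "comm_iter G ?A (K <#> R) (p - 1) = {\<one>}"
    using one_in_comm_iter [OF one_in_Omega1] extend(4) by auto
  then show ?case
    by (intro oliver_chain_extend [OF extend(5)] normal_set_mult Kn extend mono_set_mult order_refl)
qed

text \<open>Finiteness gives a maximal chain end \<open>M\<close>. Its product with any other end
  \<open>K\<close> is again an end and contains \<open>M\<close>, so it equals \<open>M\<close>,
  whence \<open>K \<subseteq> M\<close>. Thus a greatest end exists, and the definite description in
  \<open>oliver_subgroup\<close> denotes it.\<close>

lemma oliver_subgroup_props:
  assumes "finite (carrier G)"
  shows "oliver_chain G p (oliver_subgroup G p)"
    and "\<And>K. oliver_chain G p K \<Longrightarrow> K \<subseteq> oliver_subgroup G p"
proof -
  let ?X = "{K. oliver_chain G p K}"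
  have sub: "K \<subseteq> carrier G" "\<one> \<in> K" if "oliver_chain G p K" for K
    using oliver_chain_normal [OF that]
    by (auto dest!: normal_imp_subgroup intro: subgroup.one_closed dest: subgroup.subset)
  have "?X \<subseteq> Pow (carrier G)" using sub by blast
  then have fin: "finite ?X" using assms finite_subset by blast
  moreover have "?X \<noteq> {}" using oliver_chain_one by blast
  ultimately obtain M where M: "M \<in> ?X" "\<And>K. K \<in> ?X \<Longrightarrow> M \<subseteq> K \<Longrightarrow> K = M"
    using finite_has_maximal [OF fin] by blast
  have max: "K \<subseteq> M" if "oliver_chain G p K" for K
  proof -
    have "M <#> K = M"
      using M(1) that sub by (intro M(2)) (simp_all add: oliver_chain_set_mult subset_set_mult_left)
    then show ?thesis using subset_set_mult_right [of K M] sub that M(1) by auto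
  qed
  have "oliver_subgroup G p = M"
    unfolding oliver_subgroup_def
    by (rule the_equality) (use M(1) max oliver_chain_normal in \<open>blast+\<close>)
  then show "oliver_chain G p (oliver_subgroup G p)"
    and "\<And>K. oliver_chain G p K \<Longrightarrow> K \<subseteq> oliver_subgroup G p"
    using M(1) max by auto
qed

text \<open>All terms of the chain lie below \<open>K\<close>, hence in \<open>L\<close>, where they
  remain normal and keep the commutator condition.\<close>

lemma oliver_chain_restrict:
  assumes L: "subgroup L G" and "oliver_chain G p K" "K \<subseteq> L"
  shows "oliver_chain (G\<lparr>carrier := L\<rparr>) p K"
  using assms(2,3)
proof (induction rule: oliver_chain_induct)
  case one
  show ?case using group.oliver_chain_one [OF subgroup_imp_group [OF L], of p] by simp
next
  case (extend Q R)
  have "oliver_chain (G\<lparr>carrier := L\<rparr>) p Q" using extend by blast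
  moreover have "R \<lhd> G\<lparr>carrier := L\<rparr>"
    using extend L by (intro normal_restrict_supergroup) auto
  moreover have "comm_iter (G\<lparr>carrier := L\<rparr>)
      (Omega1 (G\<lparr>carrier := L\<rparr>) p (centralizer (G\<lparr>carrier := L\<rparr>) Q)) R (p - 1) = {\<one>}"
    using extend by (intro comm_iter_Omega1_centralizer_consistent [OF L])
  ultimately show ?case
    using group.oliver_chain_extend [OF subgroup_imp_group [OF L]] extend(3) by simp
qed

end

section \<open>Fixed points of \<open>p\<close>-groups\<close>

text \<open>The members of \<open>BijGroup E\<close> are extensional, hence the restriction of
  \<open>f g\<close> to \<open>E\<close>; its inverse is given by \<open>f (inv g)\<close>.\<close>

lemma group_action_restrictI:
  fixes G (structure)
  assumes "group G"
    and closed: "\<And>g x. g \<in> carrier G \<Longrightarrow> x \<in> E \<Longrightarrow> f g x \<in> E"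
    and one: "\<And>x. x \<in> E \<Longrightarrow> f \<one>\<^bsub>G\<^esub> x = x"
    and mult: "\<And>g h x. g \<in> carrier G \<Longrightarrow> h \<in> carrier G \<Longrightarrow> x \<in> E \<Longrightarrow> f (g \<otimes>\<^bsub>G\<^esub> h) x = f g (f h x)"
  shows "group_action G E (\<lambda>g. \<lambda>x\<in>E. f g x)"
proof -
  interpret group G by fact
  have bij: "(\<lambda>x\<in>E. f g x) \<in> Bij E" if g: "g \<in> carrier G" for g
  proof -
    have "bij_betw (f g) E E"
    proof (rule bij_betw_byWitness [where f' = "f (inv g)"])
      show "\<forall>x\<in>E. f (inv g) (f g x) = x" "\<forall>x\<in>E. f g (f (inv g) x) = x"
        using g one by (simp_all add: mult [symmetric])
    qed (use g closed in auto)
    then show ?thesis by (simp add: Bij_def cong: bij_betw_cong)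
  qed
  have "(\<lambda>x\<in>E. f (g \<otimes> h) x) = compose E (\<lambda>x\<in>E. f g x) (\<lambda>x\<in>E. f h x)"
    if "g \<in> carrier G" "h \<in> carrier G" for g h
    using that by (auto simp: compose_def mult closed)
  then have "(\<lambda>g. \<lambda>x\<in>E. f g x) \<in> hom G (BijGroup E)"
    using bij by (intro homI) (simp_all add: BijGroup_def)
  then show ?thesis
    by (intro group_action.intro group_hom.intro group_hom_axioms.intro group_BijGroup is_group)
qed

text \<open>Orbit lengths divide \<open>p ^ n\<close> and sum to \<open>card E\<close>. Since
  \<open>p\<close> does not divide the sum, it fails to divide some orbit length, which must then be
  1.\<close>

lemma (in group_action) p_group_fixed_point:
  assumes p: "Factorial_Ring.prime p" "order G = p ^ n" and E: "finite E" "\<not> p dvd card E"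
  shows "\<exists>x\<in>E. \<forall>g\<in>carrier G. \<phi> g x = x"
proof -
  have "card E = (\<Sum>orb\<in>orbits G E \<phi>. card orb)"
    using disjoint_sum [OF E(1), of "\<lambda>_. 1::nat"] by simp
  then have "\<not> p dvd (\<Sum>orb\<in>orbits G E \<phi>. card orb)" using E(2) by simp
  then obtain orb where orb: "orb \<in> orbits G E \<phi>" "\<not> p dvd card orb"
    using dvd_sum [of "orbits G E \<phi>" p card] by blast
  then obtain x where x: "x \<in> E" "orb = orbit G \<phi> x" by (auto simp: orbits_def)
  have "card orb dvd p ^ n"
    using orbit_stabilizer_theorem [OF x(1)] p(2) x(2) by (metis dvd_triv_left)
  then obtain i where "card orb = p ^ i" using p(1) by (auto simp: divides_primepow_nat)
  then have "card orb = 1" using orb(2) by (cases i) auto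
  then obtain y where "orb = {y}" by (auto simp: card_1_singleton_iff)
  then have "\<phi> g x = x" if "g \<in> carrier G" for g
    using that x orbit_refl [OF x(1)] unfolding orbit_def by auto
  then show ?thesis using x(1) by blast
qed

section \<open>Elements that are central modulo an invariant subgroup\<close>

context group
begin

lemma card_subgroup_prime_power:
  assumes "Factorial_Ring.prime p" "order G = p ^ n" "subgroup H G"
  obtains k where "card H = p ^ k"
  using lagrange [OF assms(3)] assms(1,2) divides_primepow_nat by (metis dvd_triv_right)

text \<open>Conjugation lets \<open>H\<close> act on the right cosets of \<open>M\<close> in
  \<open>N\<close> other than \<open>M\<close> itself. Their number is the index minus 1, hence
  prime to \<open>p\<close>, so some coset \<open>M #> g\<close> is fixed. This says that
  \<open>g\<close> commutes with \<open>H\<close> modulo \<open>M\<close>.\<close>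

lemma normalized_subgroups_central_element:
  assumes p: "Factorial_Ring.prime p" "order G = p ^ n"
    and sub: "subgroup H G" "subgroup N G" "subgroup M G" "M \<subset> N"
    and N: "\<And>h x. h \<in> H \<Longrightarrow> x \<in> N \<Longrightarrow> h \<otimes> x \<otimes> inv h \<in> N"
    and M: "\<And>h x. h \<in> H \<Longrightarrow> x \<in> M \<Longrightarrow> h \<otimes> x \<otimes> inv h \<in> M"
  obtains g where "g \<in> N - M" "\<And>h. h \<in> H \<Longrightarrow> g \<otimes> h \<otimes> inv g \<otimes> inv h \<in> M"
proof -
  have Hc: "H \<subseteq> carrier G" and Nc: "N \<subseteq> carrier G" and Mc: "M \<subseteq> carrier G"
    using sub by (auto dest: subgroup.subset)
  have "order G > 0" using p by (simp add: prime_gt_0_nat)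
  then have fin: "finite (carrier G)" by (simp add: order_gt_0_iff_finite)
  let ?c = "\<lambda>h x. h \<otimes> x \<otimes> inv h"
  let ?R = "rcosets\<^bsub>G\<lparr>carrier := N\<rparr>\<^esub> M"
  let ?E = "?R - {M}"
  let ?f = "\<lambda>h C. ?c h ` C"
  have R: "?R = (\<lambda>g. M #> g) ` N" by (auto simp: RCOSETS_def)
  have MR: "M \<in> ?R"
    unfolding R using coset_mult_one [OF Mc] subgroup.one_closed [OF sub(2)] by (metis imageI)
  have conjM: "?c h ` M = M" if h: "h \<in> H" for h
  proof
    show "?c h ` M \<subseteq> M" using M h by blast
    have "inv h \<in> H" using h sub(1) by (rule subgroup.m_inv_closed [rotated])
    show "M \<subseteq> ?c h ` M"
    proof
      fix m assume m: "m \<in> M"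
      have "m = ?c h (?c (inv h) m)" using h m Hc Mc by (simp add: group_cancel subset_iff)
      then show "m \<in> ?c h ` M" using M [OF \<open>inv h \<in> H\<close> m] by blast
    qed
  qed
  have conj: "?f h (M #> g) = M #> ?c h g" if h: "h \<in> H" and g: "g \<in> N" for h g
  proof -
    have c: "h \<in> carrier G" "g \<in> carrier G" using h g Hc Nc by auto
    have "?f h (M #> g) = (\<lambda>m. ?c h (m \<otimes> g)) ` M" by (auto simp: r_coset_def)
    also have "\<dots> = (\<lambda>m. ?c h m \<otimes> ?c h g) ` M"
      using c Mc by (intro image_cong refl) (simp add: group_cancel subset_iff)
    also have "\<dots> = (\<lambda>m. m \<otimes> ?c h g) ` (?c h ` M)" by (simp add: image_image)
    also have "\<dots> = M #> ?c h g" unfolding conjM [OF h] by (auto simp: r_coset_def)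
    finally show ?thesis .
  qed
  have comp: "?f (h \<otimes> k) C = ?f h (?f k C)" if "h \<in> H" "k \<in> H" "C \<in> ?R" for h k C
  proof -
    have C: "C \<subseteq> carrier G" using that(3) Mc Nc unfolding R
      by (metis (no_types, lifting) imageE r_coset_subset_G subsetD)
    have "h \<in> carrier G" "k \<in> carrier G" using that Hc by auto
    then show ?thesis unfolding image_image
      using C by (intro image_cong refl) (simp add: group_cancel subset_iff)
  qed
  have id: "?f \<one> C = C" if "C \<in> ?R" for C
  proof -
    have "C \<subseteq> carrier G" using that Mc Nc unfolding R
      by (metis (no_types, lifting) imageE r_coset_subset_G subsetD)
    then show ?thesis by (force simp: subset_iff)
  qed
  have closed: "?f h C \<in> ?E" if h: "h \<in> H" and C: "C \<in> ?E" for h C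
  proof -
    obtain g where g: "g \<in> N" "C = M #> g" using C R by auto
    then have "?f h C \<in> ?R" using conj [OF h g(1)] N [OF h g(1)] R by auto
    moreover have "?f h C \<noteq> M"
    proof
      assume eq: "?f h C = M"
      have h': "inv h \<in> H" using h sub(1) by (rule subgroup.m_inv_closed [rotated])
      have "C = ?f (inv h \<otimes> h) C" using id C h Hc by (simp add: subset_iff)
      also have "\<dots> = ?f (inv h) M" using comp [OF h' h] C eq by simp
      also have "\<dots> = M" by (rule conjM [OF h'])
      finally show False using C by blast
    qed
    ultimately show ?thesis by blast
  qed
  interpret A: group_action "G\<lparr>carrier := H\<rparr>" ?E "\<lambda>h. \<lambda>C\<in>?E. ?f h C"
  proof (rule group_action_restrictI)
    show "group (G\<lparr>carrier := H\<rparr>)" by (rule subgroup_imp_group [OF sub(1)])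
  qed (use closed id comp in auto)
  obtain k where k: "order (G\<lparr>carrier := H\<rparr>) = p ^ k"
    using card_subgroup_prime_power [OF p sub(1)] by (auto simp: order_def)
  have finR: "finite ?R" unfolding R using fin Nc finite_subset by blast
  have lag: "card ?R * card M = card N"
    using group.lagrange [OF subgroup_imp_group [OF sub(2)], of M] sub
    by (simp add: order_def subgroup_incl)
  obtain j where j: "card N = p ^ j" using card_subgroup_prime_power [OF p sub(2)] .
  have "card ?R dvd p ^ j" using lag j by (metis dvd_triv_left)
  then obtain i where i: "card ?R = p ^ i" using p(1) by (auto simp: divides_primepow_nat)
  have "card M < card N" using sub(4) Nc fin by (meson finite_subset psubset_card_mono)
  then have "i \<noteq> 0" using lag i by (intro notI) simp
  then have "p dvd card ?R" using i by simp
  moreover have "card ?R = Suc (card ?E)" using MR finR by (metis card_Suc_Diff1)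
  ultimately have "\<not> p dvd card ?E" using p(1)
    by (metis One_nat_def dvd_add_right_iff nat_dvd_1_iff_1 not_prime_1 plus_1_eq_Suc add.commute)
  then obtain C where C: "C \<in> ?E" and fixed: "\<And>h. h \<in> H \<Longrightarrow> ?f h C = C"
    using A.p_group_fixed_point [OF p(1) k] finR by auto
  obtain g where g: "g \<in> N" "C = M #> g" using C R by auto
  have gc: "g \<in> carrier G" using g Nc by blast
  have "g \<notin> M" using C g coset_join2 [OF gc sub(3)] by auto
  moreover have "g \<otimes> h \<otimes> inv g \<otimes> inv h \<in> M" if h: "h \<in> H" for h
  proof -
    have hc: "h \<in> carrier G" using h Hc by blast
    have "?c h g \<in> M #> ?c h g" using hc gc sub(3) by (intro rcos_self) auto
    \<comment> \<open>Invariance of the coset puts the commutator of \<open>h\<close> and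
      \<open>g\<close> in \<open>M\<close>; the required commutator of \<open>g\<close> and
      \<open>h\<close> is its inverse.\<close>
    then have "?c h g \<in> M #> g" using conj [OF h g(1)] fixed [OF h] g(2) by simp
    then obtain m where m: "m \<in> M" "?c h g = m \<otimes> g" by (auto simp: r_coset_def)
    have mc: "m \<in> carrier G" using m Mc by blast
    have "m = ?c h g \<otimes> inv g" using m mc gc by (simp add: m_assoc)
    then have "inv m = g \<otimes> h \<otimes> inv g \<otimes> inv h" using hc gc by (simp add: group_cancel)
    then show ?thesis using m(1) subgroup.m_inv_closed [OF sub(3)] by metis
  qed
  ultimately show thesis using that g(1) by blast
qed

end

section \<open>Elementary abelian subgroups and Thompson replacement\<close>

locale finite_p_group = group G for G (structure) +
  fixes p :: nat
  assumes p_group: "p_group G p"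
begin

lemma finite_carrier: "finite (carrier G)"
  and prime: "Factorial_Ring.prime p"
  using p_group by (auto simp: p_group_def)

lemma order_prime_power: obtains n where "order G = p ^ n"
  using p_group by (auto simp: p_group_def)

lemma finite_subgroup: "subgroup H G \<Longrightarrow> finite H"
  using finite_carrier by (meson finite_subset subgroup.subset)

text \<open>Every subgroup has \<open>p\<close>-power order, so the multiplicity of \<open>p\<close>
  determines the order. Ranks can therefore be compared through cardinalities.\<close>

lemma card_eq_power_el_rank:
  assumes "subgroup H G"
  shows "card H = p ^ el_rank p H"
proof -
  obtain n where "order G = p ^ n" by (rule order_prime_power)
  then obtain k where "card H = p ^ k" using card_subgroup_prime_power [OF prime] assms by blast
  then show ?thesis
    using prime by (simp add: el_rank_def multiplicity_same_power prime_gt_1_nat)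
qed

lemma el_rank_le_iff_card_le:
  assumes "subgroup H G" "subgroup K G"
  shows "el_rank p H \<le> el_rank p K \<longleftrightarrow> card H \<le> card K"
  using prime_gt_1_nat [OF prime]
  by (simp add: card_eq_power_el_rank [OF assms(1)] card_eq_power_el_rank [OF assms(2)])

lemma elementary_abelian_subgroup:
  assumes "elementary_abelian G p E" "subgroup H G" "H \<subseteq> E"
  shows "elementary_abelian G p H"
  using assms unfolding elementary_abelian_def by blast

lemma elementary_abelian_set_mult:
  assumes E: "elementary_abelian G p E" and F: "elementary_abelian G p F"
    and comm: "\<And>e f. e \<in> E \<Longrightarrow> f \<in> F \<Longrightarrow> e \<otimes> f = f \<otimes> e"
  shows "elementary_abelian G p (E <#> F)"
proof -
  have sub: "subgroup E G" "subgroup F G" using E F by (auto simp: elementary_abelian_def)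
  have c: "\<And>e. e \<in> E \<Longrightarrow> e \<in> carrier G" "\<And>f. f \<in> F \<Longrightarrow> f \<in> carrier G"
    using sub by (auto dest: subgroup.mem_carrier)
  have prod: "e \<otimes> f \<otimes> (e' \<otimes> f') = (e \<otimes> e') \<otimes> (f \<otimes> f')"
    if "e \<in> E" "e' \<in> E" "f \<in> F" "f' \<in> F" for e e' f f'
  proof -
    have "e \<otimes> f \<otimes> (e' \<otimes> f') = e \<otimes> (f \<otimes> e') \<otimes> f'" using that c by (simp add: m_assoc)
    also have "\<dots> = e \<otimes> (e' \<otimes> f) \<otimes> f'" using comm [OF that(2,3)] by simp
    finally show ?thesis using that c by (simp add: m_assoc)
  qed
  have "subgroup (E <#> F) G"
  proof (rule subgroupI)
    show "E <#> F \<subseteq> carrier G" using c by (auto simp: set_mult_def)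
    show "E <#> F \<noteq> {}" using sub by (auto simp: set_mult_def dest: subgroup.one_closed)
    fix a assume "a \<in> E <#> F"
    then obtain e f where a: "e \<in> E" "f \<in> F" "a = e \<otimes> f" by (auto simp: set_mult_def)
    then have "inv a = inv e \<otimes> inv f" using c comm [OF a(1,2)] by (simp add: inv_mult_group [symmetric])
    then show "inv a \<in> E <#> F" using a sub by (auto simp: set_mult_def dest: subgroup.m_inv_closed)
    fix b assume "b \<in> E <#> F"
    then obtain e' f' where b: "e' \<in> E" "f' \<in> F" "b = e' \<otimes> f'" by (auto simp: set_mult_def)
    have "e \<otimes> e' \<in> E" "f \<otimes> f' \<in> F" using a b sub by (simp_all add: subgroup.m_closed)
    moreover have "a \<otimes> b = (e \<otimes> e') \<otimes> (f \<otimes> f')" using a b prod by simp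
    ultimately show "a \<otimes> b \<in> E <#> F" by (auto simp: set_mult_def)
  qed
  moreover have "a \<otimes> b = b \<otimes> a" if prems: "a \<in> E <#> F" "b \<in> E <#> F" for a b
  proof -
    obtain e f e' f' where ab: "e \<in> E" "f \<in> F" "a = e \<otimes> f" "e' \<in> E" "f' \<in> F" "b = e' \<otimes> f'"
      using prems by (auto simp: set_mult_def)
    have "e \<otimes> e' = e' \<otimes> e" "f \<otimes> f' = f' \<otimes> f"
      using ab E F by (simp_all add: elementary_abelian_def)
    then show ?thesis using ab by (simp add: prod)
  qed
  moreover have "a [^] p = \<one>" if prems: "a \<in> E <#> F" for a
  proof -
    obtain e f where a: "e \<in> E" "f \<in> F" "a = e \<otimes> f" using prems by (auto simp: set_mult_def)
    then have "a [^] p = e [^] p \<otimes> f [^] p" using c pow_mult_distrib [OF comm [OF a(1,2)]] by simp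
    then show ?thesis using a E F by (simp add: elementary_abelian_def)
  qed
  ultimately show ?thesis by (simp add: elementary_abelian_def)
qed

text \<open>Of largest rank, not merely maximal under inclusion: these are the subgroups that
  generate \<open>thompson_subgroup G p\<close>.\<close>

definition maximal_elementary_abelian :: "'a set \<Rightarrow> bool" where
  "maximal_elementary_abelian E \<longleftrightarrow> elementary_abelian G p E \<and> el_rank p E = p_rank G p"

lemma el_rank_le_p_rank:
  assumes "elementary_abelian G p E"
  shows "el_rank p E \<le> p_rank G p"
  unfolding p_rank_def
proof (rule Max_ge)
  have "{E. elementary_abelian G p E} \<subseteq> Pow (carrier G)"
    by (auto simp: elementary_abelian_def dest: subgroup.mem_carrier)
  then have "finite {E. elementary_abelian G p E}" using finite_carrier finite_subset by blast
  then show "finite {el_rank p E |E. elementary_abelian G p E}" by simp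
qed (use assms in blast)

lemma maximal_elementary_abelian_card_le:
  assumes "maximal_elementary_abelian E" "elementary_abelian G p F"
  shows "card F \<le> card E"
  using assms el_rank_le_p_rank [OF assms(2)] el_rank_le_iff_card_le [of F E]
  by (auto simp: maximal_elementary_abelian_def elementary_abelian_def)

lemma maximal_elementary_abelian_card_ge:
  assumes "maximal_elementary_abelian E" "elementary_abelian G p F" "card E \<le> card F"
  shows "maximal_elementary_abelian F"
  using assms el_rank_le_p_rank [OF assms(2)] el_rank_le_iff_card_le [of E F]
  by (auto simp: maximal_elementary_abelian_def elementary_abelian_def)

text \<open>The product \<open>E <#> F\<close> is elementary abelian and contains \<open>E\<close>,
  so by maximality of the rank it equals \<open>E\<close>.\<close>

lemma maximal_elementary_abelian_absorb:
  assumes E: "maximal_elementary_abelian E" and F: "elementary_abelian G p F"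
    and comm: "\<And>e f. e \<in> E \<Longrightarrow> f \<in> F \<Longrightarrow> e \<otimes> f = f \<otimes> e"
  shows "F \<subseteq> E"
proof -
  have Ee: "elementary_abelian G p E" using E by (simp add: maximal_elementary_abelian_def)
  have sub: "subgroup E G" "subgroup F G" using Ee F by (auto simp: elementary_abelian_def)
  have EF: "elementary_abelian G p (E <#> F)"
    by (rule elementary_abelian_set_mult [OF Ee F comm])
  then have fin: "finite (E <#> F)" by (simp add: elementary_abelian_def finite_subgroup)
  have incl: "E \<subseteq> E <#> F" "F \<subseteq> E <#> F"
    using sub by (simp_all add: subset_set_mult_left subset_set_mult_right subgroup.subset subgroup.one_closed)
  have "E = E <#> F"
    using card_seteq [OF fin incl(1)] maximal_elementary_abelian_card_le [OF E EF] by blast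
  then show ?thesis using incl by blast
qed

text \<open>Write \<open>V\<close> additively, as a module over \<open>A\<close>. The map
  \<open>a \<mapsto> (a - 1) x\<close> induces an injection of \<open>A / C\<^sub>A(M)\<close> into \<open>M / (M \<inter> A)\<close>, because
  \<open>(d - 1) (a - b) x = 0\<close> for all \<open>d\<close> says that \<open>a - b\<close> kills \<open>M\<close>; so \<open>M C\<^sub>A(M)\<close> is as large
  as \<open>A\<close>.\<close>

lemma thompson_replacement:
  assumes A: "maximal_elementary_abelian A"
    and V: "elementary_abelian G p V" "V \<lhd> G"
    and not_quadratic: "\<not> (\<forall>v\<in>V. \<forall>a\<in>A. v \<otimes> a \<otimes> inv v \<otimes> inv a \<in> centralizer G A)"
  obtains A' where "maximal_elementary_abelian A'" "A \<inter> V \<subset> A' \<inter> V" "\<not> A' \<subseteq> centralizer G V"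
proof -
  define c where "c v a = v \<otimes> a \<otimes> inv v \<otimes> inv a" for v a
  have Ae: "elementary_abelian G p A" using A by (simp add: maximal_elementary_abelian_def)
  have As: "subgroup A G" and Vs: "subgroup V G"
    using Ae V by (auto simp: elementary_abelian_def)
  have Acomm: "a \<otimes> b = b \<otimes> a" if "a \<in> A" "b \<in> A" for a b
    using Ae that by (auto simp: elementary_abelian_def)
  have Vcomm: "v \<otimes> w = w \<otimes> v" if "v \<in> V" "w \<in> V" for v w
    using V that by (auto simp: elementary_abelian_def)
  have [simp]: "a \<in> carrier G" if "a \<in> A" for a using As that by (rule subgroup.mem_carrier)
  have [simp]: "v \<in> carrier G" if "v \<in> V" for v using Vs that by (rule subgroup.mem_carrier)
  have Vinv: "inv v \<in> V" if "v \<in> V" for v using Vs that by (rule subgroup.m_inv_closed)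
  have Vmul: "v \<otimes> w \<in> V" if "v \<in> V" "w \<in> V" for v w using Vs that by (rule subgroup.m_closed)
  have Ainv: "inv a \<in> A" if "a \<in> A" for a using As that by (rule subgroup.m_inv_closed)
  have Amul: "a \<otimes> b \<in> A" if "a \<in> A" "b \<in> A" for a b using As that by (rule subgroup.m_closed)
  have Vconj: "g \<otimes> v \<otimes> inv g \<in> V" if "g \<in> carrier G" "v \<in> V" for g v
    using V(2) that by (rule normal.inv_op_closed2)
  have cV: "c v a \<in> V" if "v \<in> V" "a \<in> A" for v a
  proof -
    have "c v a = v \<otimes> (a \<otimes> inv v \<otimes> inv a)" using that by (simp add: c_def m_assoc)
    then show ?thesis using that Vconj Vinv Vmul by simp
  qed
  let ?Z = "centralizer G A"
  have Z: "subgroup ?Z G" using As by (intro centralizer_is_subgroup subgroup.subset)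
  have AZ: "A \<subseteq> ?Z" using Acomm by (auto simp: centralizer_def)
  \<comment> \<open>\<open>B\<close> is the part of \<open>V\<close> on which \<open>A\<close> acts
    quadratically. By \<open>not_quadratic\<close> it is proper.\<close>
  define B where "B = {v \<in> V. \<forall>a\<in>A. c v a \<in> ?Z}"
  have BV: "B \<subseteq> V" by (auto simp: B_def)
  have cmul: "c (v \<otimes> w) a = c w a \<otimes> c v a" if "v \<in> V" "w \<in> V" "a \<in> A" for v w a
  proof -
    have "c (v \<otimes> w) a = v \<otimes> c w a \<otimes> (a \<otimes> inv v \<otimes> inv a)"
      using that by (simp add: c_def group_cancel)
    also have "\<dots> = c w a \<otimes> v \<otimes> (a \<otimes> inv v \<otimes> inv a)"
      using Vcomm [OF that(1) cV [OF that(2,3)]] by simp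
    also have "\<dots> = c w a \<otimes> c v a" using that cV [OF that(2,3)] by (simp add: c_def [of v] m_assoc)
    finally show ?thesis .
  qed
  have one: "c \<one> a = \<one>" if "a \<in> A" for a using that by (simp add: c_def)
  have Bs: "subgroup B G"
  proof (rule subgroupI)
    show "B \<subseteq> carrier G" using BV by auto
    have "\<one> \<in> B" using subgroup.one_closed [OF Vs] subgroup.one_closed [OF Z] one by (simp add: B_def)
    then show "B \<noteq> {}" by blast
    fix v assume v: "v \<in> B"
    then have vV: "v \<in> V" using BV by blast
    have "c (inv v) a \<in> ?Z" if a: "a \<in> A" for a
    proof -
      have "c (inv v) a \<otimes> c v a = c (v \<otimes> inv v) a"
        using cmul [of v "inv v" a] vV Vinv a by simp
      also have "\<dots> = \<one>" using vV one [OF a] by simp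
      finally have "c (inv v) a = inv (c v a)"
        using inv_equality cV [OF vV a] cV [OF Vinv [OF vV] a] by simp
      then show ?thesis using v a subgroup.m_inv_closed [OF Z] by (simp add: B_def)
    qed
    then show "inv v \<in> B" using Vinv [OF vV] by (simp add: B_def)
    fix w assume w: "w \<in> B"
    then have "w \<in> V" using BV by blast
    then show "v \<otimes> w \<in> B"
      using v w vV Vmul cmul subgroup.m_closed [OF Z] by (simp add: B_def)
  qed
  \<comment> \<open>Since \<open>A\<close> is abelian, the commutator of
    \<open>b \<otimes> v \<otimes> inv b\<close> with \<open>a\<close> is the conjugate of
    \<open>c v a\<close> by \<open>b\<close>, and \<open>c v a\<close> commutes with
    \<open>b\<close>.\<close>
  have Bconj: "b \<otimes> v \<otimes> inv b \<in> B" if b: "b \<in> A" and v: "v \<in> B" for b v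
  proof -
    have vV: "v \<in> V" using v BV by blast
    have "c (b \<otimes> v \<otimes> inv b) a \<in> ?Z" if a: "a \<in> A" for a
    proof -
      have ab: "inv b \<otimes> a = a \<otimes> inv b" using Acomm a Ainv [OF b] by simp
      have "inv b \<otimes> inv a = inv a \<otimes> inv b" using Acomm Ainv a b by simp
      then have "c (b \<otimes> v \<otimes> inv b) a = b \<otimes> v \<otimes> (inv b \<otimes> a) \<otimes> b \<otimes> inv v \<otimes> (inv a \<otimes> inv b)"
        using a b vV by (simp add: c_def group_cancel)
      also have "\<dots> = b \<otimes> c v a \<otimes> inv b"
        unfolding ab using a b vV by (simp add: c_def group_cancel)
      also have "\<dots> = c v a \<otimes> b \<otimes> inv b"
        using v a b by (simp add: B_def centralizer_def)
      also have "\<dots> = c v a" using b cV [OF vV a] by (simp add: m_assoc)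
      finally show ?thesis using v a by (simp add: B_def)
    qed
    then show ?thesis using Vconj vV b by (simp add: B_def)
  qed
  have "B \<subset> V" using not_quadratic BV by (auto simp: B_def c_def)
  obtain n where n: "order G = p ^ n" by (rule order_prime_power)
  \<comment> \<open>A nontrivial fixed point of \<open>A\<close> on \<open>V\<close> modulo
    \<open>B\<close>: cubic action on \<open>x\<close>, but not quadratic.\<close>
  obtain x where x: "x \<in> V - B" and xB: "\<And>a. a \<in> A \<Longrightarrow> c x a \<in> B"
    using normalized_subgroups_central_element [OF prime n As Vs Bs \<open>B \<subset> V\<close> _ Bconj] Vconj
    unfolding c_def by (metis \<open>\<And>a. a \<in> A \<Longrightarrow> a \<in> carrier G\<close>)
  have xV: "x \<in> V" using x by blast
  define M where "M = generate G (c x ` A)"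
  have cM: "c x a \<in> M" if "a \<in> A" for a using that by (auto simp: M_def intro: generate.incl)
  have MB: "M \<subseteq> B" unfolding M_def using xB by (intro generate_subgroup_incl Bs) auto
  have Ms: "subgroup M G" unfolding M_def using cV xV by (intro generate_is_subgroup) auto
  define C where "C = A \<inter> centralizer G M"
  have Cs: "subgroup C G"
    unfolding C_def using As Ms
    by (intro subgroups_Inter_pair centralizer_is_subgroup) (auto dest: subgroup.subset)
  have CA: "C \<subseteq> A" by (simp add: C_def)
  have CI: "y \<in> C" if y: "y \<in> A" "\<And>d. d \<in> A \<Longrightarrow> y \<otimes> c x d = c x d \<otimes> y" for y
  proof -
    have "subgroup (centralizer G {y}) G" using y(1) by (intro centralizer_is_subgroup) auto
    moreover have "c x ` A \<subseteq> centralizer G {y}" using y cV xV by (auto simp: centralizer_def)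
    ultimately have "M \<subseteq> centralizer G {y}" unfolding M_def by (intro generate_subgroup_incl)
    then show ?thesis using y(1) by (auto simp: C_def centralizer_def)
  qed
  \<comment> \<open>Additively, \<open>w a\<close> is the image of \<open>x\<close> under
    \<open>a\<close>, and \<open>c x a\<close> is the difference of \<open>x\<close> and
    \<open>w a\<close>.\<close>
  define w where "w a = a \<otimes> x \<otimes> inv a" for a
  have wV: "w a \<in> V" if "a \<in> A" for a using that xV Vconj by (simp add: w_def)
  have cw: "c x a = x \<otimes> inv (w a)" if "a \<in> A" for a
    using that xV by (simp add: c_def w_def group_cancel)
  have wmul: "a \<otimes> w b \<otimes> inv a = w (a \<otimes> b)" if "a \<in> A" "b \<in> A" for a b
    using that xV by (simp add: w_def group_cancel)
  \<comment> \<open>If \<open>w a\<close> and \<open>w b\<close> differ by an element fixed by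
    \<open>A\<close>, applying \<open>d\<close> shows that \<open>w (d \<otimes> a)\<close> and
    \<open>w (d \<otimes> b)\<close> differ by the same element. Regrouping, \<open>a\<close> and
    \<open>b\<close> conjugate every generator \<open>c x d\<close> of \<open>M\<close> in the same
    way, so \<open>inv b \<otimes> a\<close> centralizes \<open>M\<close>.\<close>
  have key: "inv b \<otimes> a \<in> C"
    if a: "a \<in> A" and b: "b \<in> A" and z: "inv (w a) \<otimes> w b \<in> ?Z" for a b
  proof (rule CI)
    show "inv b \<otimes> a \<in> A" using a b Ainv Amul by blast
    fix d assume d: "d \<in> A"
    have da: "d \<otimes> a \<in> A" "d \<otimes> b \<in> A" using a b d Amul by auto
    note V' = wV [OF a] wV [OF b] wV [OF da(1)] wV [OF da(2)]
    have "d \<otimes> (inv (w a) \<otimes> w b) = (inv (w a) \<otimes> w b) \<otimes> d"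
      using z d by (simp add: centralizer_def)
    then have "d \<otimes> (inv (w a) \<otimes> w b) \<otimes> inv d = inv (w a) \<otimes> w b"
      using d V' by (simp add: m_assoc)
    moreover have "d \<otimes> (inv (w a) \<otimes> w b) \<otimes> inv d
        = inv (d \<otimes> w a \<otimes> inv d) \<otimes> (d \<otimes> w b \<otimes> inv d)"
      using d V' by (simp add: group_cancel)
    ultimately have eq: "inv (w (d \<otimes> a)) \<otimes> w (d \<otimes> b) = inv (w a) \<otimes> w b"
      using wmul a b d by simp
    have "w a \<otimes> inv (w (d \<otimes> a)) = w a \<otimes> (inv (w (d \<otimes> a)) \<otimes> w (d \<otimes> b)) \<otimes> inv (w (d \<otimes> b))"
      using V' by (simp add: m_assoc)
    also have "\<dots> = w b \<otimes> inv (w (d \<otimes> b))"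
      unfolding eq using V' by (simp add: group_cancel)
    finally have "w a \<otimes> inv (w (d \<otimes> a)) = w b \<otimes> inv (w (d \<otimes> b))" .
    moreover have "e \<otimes> c x d \<otimes> inv e = w e \<otimes> inv (w (d \<otimes> e))" if e: "e \<in> A" for e
    proof -
      have "e \<otimes> c x d \<otimes> inv e = (e \<otimes> x \<otimes> inv e) \<otimes> inv (e \<otimes> w d \<otimes> inv e)"
        unfolding cw [OF d] using e d xV wV [OF d] by (simp add: group_cancel)
      then show ?thesis unfolding wmul [OF e d] Acomm [OF e d] by (simp add: w_def)
    qed
    ultimately have "a \<otimes> c x d \<otimes> inv a = b \<otimes> c x d \<otimes> inv b" using a b by simp
    then have "inv b \<otimes> (a \<otimes> c x d \<otimes> inv a) \<otimes> a = inv b \<otimes> (b \<otimes> c x d \<otimes> inv b) \<otimes> a" by simp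
    then show "inv b \<otimes> a \<otimes> c x d = c x d \<otimes> (inv b \<otimes> a)"
      using a b cV [OF xV d] by (simp add: group_cancel)
  qed
  define A' where "A' = M <#> C"
  have MV: "M \<subseteq> V" using MB BV by blast
  have A'e: "elementary_abelian G p A'"
    unfolding A'_def
  proof (rule elementary_abelian_set_mult)
    show "elementary_abelian G p M" by (rule elementary_abelian_subgroup [OF V(1) Ms MV])
    show "elementary_abelian G p C" by (rule elementary_abelian_subgroup [OF Ae Cs CA])
  qed (auto simp: C_def centralizer_def)
  then have A's: "subgroup A' G" by (simp add: elementary_abelian_def)
  have card: "card A \<le> card A'"
  proof (rule card_inj_on_le)
    \<comment> \<open>The choice \<open>r a\<close> depends only on the coset of \<open>a\<close>
      modulo \<open>C\<close>. In \<open>f a\<close> the factor from \<open>M\<close> encodes the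
      coset and the factor from \<open>C\<close> the position of \<open>a\<close> within it.\<close>
    define r where "r a = (SOME b. b \<in> C #> a)" for a
    define f where "f a = c x (r a) \<otimes> (inv (r a) \<otimes> a)" for a
    have rC: "r a \<in> C #> a" if "a \<in> A" for a
      unfolding r_def using rcos_self [of a C] Cs that by (intro someI_ex [of "\<lambda>b. b \<in> C #> a"]) auto
    have rA: "r a \<in> A" if "a \<in> A" for a
      using rC [OF that] CA Amul that by (auto simp: r_coset_def)
    have coset: "C #> r a = C #> a" if "a \<in> A" for a
      using repr_independence [OF rC [OF that] _ Cs] that by simp
    have mem: "inv (r a) \<otimes> a \<in> C" if a: "a \<in> A" for a
    proof -
      obtain k where k: "k \<in> C" "r a = k \<otimes> a" using rC [OF a] by (auto simp: r_coset_def)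
      have "k \<in> A" using k CA by blast
      then have "inv (r a) \<otimes> a = inv a \<otimes> (inv k \<otimes> a)" using k a by (simp add: group_cancel)
      also have "\<dots> = inv a \<otimes> (a \<otimes> inv k)" using Acomm [of a "inv k"] Ainv \<open>k \<in> A\<close> a by simp
      also have "\<dots> = inv k" using \<open>k \<in> A\<close> a by (simp add: group_cancel)
      finally show ?thesis using k subgroup.m_inv_closed [OF Cs] by simp
    qed
    show "f ` A \<subseteq> A'"
    proof (rule image_subsetI)
      fix a assume "a \<in> A"
      then have "c x (r a) \<in> M" "inv (r a) \<otimes> a \<in> C" using cM rA mem by auto
      then show "f a \<in> A'" unfolding f_def A'_def set_mult_def by blast
    qed
    show "finite A'" by (rule finite_subgroup [OF A's])
    show "inj_on f A"
    proof (rule inj_onI)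
      fix a b assume a: "a \<in> A" and b: "b \<in> A" and eq: "f a = f b"
      let ?a = "inv (r a) \<otimes> a" and ?b = "inv (r b) \<otimes> b"
      have carr: "?a \<in> carrier G" "?b \<in> carrier G" "c x (r a) \<in> carrier G" "c x (r b) \<in> carrier G"
        using a b rA cV xV by simp_all
      have "inv (c x (r b)) \<otimes> (c x (r a) \<otimes> ?a) \<otimes> inv ?a = inv (c x (r b)) \<otimes> (c x (r b) \<otimes> ?b) \<otimes> inv ?a"
        using eq by (simp add: f_def)
      then have "inv (c x (r b)) \<otimes> c x (r a) = ?b \<otimes> inv ?a"
        using carr by (simp add: m_assoc inv_mult_cancel del: inv_mult_group)
      also have "\<dots> \<in> A" using mem [OF a] mem [OF b] CA Ainv Amul by blast
      \<comment> \<open>Equal values of \<open>f\<close> force the quotient of the two factors from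
        \<open>M\<close> to lie in \<open>C\<close>, hence in the abelian group \<open>A\<close>. So
        \<open>A\<close> fixes it, which is the hypothesis of \<open>key\<close>.\<close>
      finally have 1: "inv (c x (r b)) \<otimes> c x (r a) \<in> ?Z" using AZ by blast
      have ww: "w (r a) \<in> V" "w (r b) \<in> V" using rA a b wV by auto
      have "inv (c x (r b)) \<otimes> c x (r a) = w (r b) \<otimes> inv (w (r a))"
        using rA a b ww xV by (simp add: cw group_cancel)
      also have "\<dots> = inv (w (r a)) \<otimes> w (r b)" using ww Vcomm Vinv by simp
      finally have "inv (r b) \<otimes> r a \<in> C" using 1 key rA a b by simp
      then have "(inv (r b) \<otimes> r a) \<otimes> r b \<in> C #> r b"
        using rcosI [OF _ subgroup.subset [OF Cs]] rA b by simp
      moreover have "(inv (r b) \<otimes> r a) \<otimes> r b = r a"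
        using rA a b Acomm [of "r a" "r b"] by (simp add: group_cancel)
      ultimately have "r a \<in> C #> r b" by simp
      then have "C #> r b = C #> r a" using repr_independence [OF _ _ Cs] rA b by simp
      then have "C #> a = C #> b" using coset a b by simp
      then have r: "r a = r b" by (simp add: r_def)
      have "c x (r b) \<otimes> (inv (r b) \<otimes> a) = c x (r b) \<otimes> (inv (r b) \<otimes> b)" using eq by (simp add: f_def r)
      then show "a = b" using a b rA carr by simp
    qed
  qed
  have A'max: "maximal_elementary_abelian A'"
    by (rule maximal_elementary_abelian_card_ge [OF A A'e card])
  \<comment> \<open>The replacement loses nothing of \<open>A \<inter> V\<close>, because
    \<open>V\<close> is abelian and contains \<open>M\<close>.\<close>
  have AV: "A \<inter> V \<subseteq> C" using MV Vcomm by (auto simp: C_def centralizer_def)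
  have "C \<subseteq> A'" "M \<subseteq> A'"
    unfolding A'_def using Ms Cs
    by (simp_all add: subset_set_mult_left subset_set_mult_right subgroup.subset subgroup.one_closed)
  then have "A \<inter> V \<subseteq> A' \<inter> V" using AV by blast
  \<comment> \<open>Strictness: \<open>x\<close> lies outside \<open>B\<close>, so some
    \<open>c x a\<close> fails to centralize \<open>A\<close> and is thus outside \<open>A\<close>,
    although it lies in \<open>M\<close>.\<close>
  moreover obtain a where "a \<in> A" "c x a \<notin> A" using x AZ by (auto simp: B_def)
  moreover have "c x a \<in> A' \<inter> V" using \<open>a \<in> A\<close> cM cV xV \<open>M \<subseteq> A'\<close> by blast
  ultimately have 1: "A \<inter> V \<subset> A' \<inter> V" by blast
  \<comment> \<open>Otherwise \<open>V\<close> is absorbed by \<open>A' = M <#> C\<close>, and each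
    \<open>v\<close> in \<open>V\<close> is a product of some \<open>m\<close> in \<open>M\<close>,
    hence in \<open>B\<close>, and some \<open>k\<close> in \<open>C \<inter> V\<close>. As
    \<open>k\<close> lies in \<open>A\<close>, its commutators with \<open>A\<close> vanish, so
    \<open>k\<close> is in \<open>B\<close> too. This would make \<open>V\<close> equal to
    \<open>B\<close>.\<close>
  have 2: "\<not> A' \<subseteq> centralizer G V"
  proof
    assume "A' \<subseteq> centralizer G V"
    then have "V \<subseteq> A'"
      by (intro maximal_elementary_abelian_absorb [OF A'max V(1)]) (auto simp: centralizer_def)
    have "V \<subseteq> B"
    proof
      fix v assume v: "v \<in> V"
      then obtain m k where mk: "m \<in> M" "k \<in> C" "v = m \<otimes> k"
        using \<open>V \<subseteq> A'\<close> by (auto simp: A'_def set_mult_def)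
      have mV: "m \<in> V" and kA: "k \<in> A" using mk MV CA by auto
      have "k = inv m \<otimes> v" using mk mV kA by (simp add: inv_mult_cancel)
      then have kV: "k \<in> V" using mV v Vinv Vmul by simp
      have "c k a = \<one>" if "a \<in> A" for a
        unfolding c_def using kA that Acomm [OF kA that] by (subst commutator_eq_one_iff) simp_all
      then have "k \<in> B" using kV subgroup.one_closed [OF Z] by (simp add: B_def)
      then show "v \<in> B" using mk MB subgroup.m_closed [OF Bs] by blast
    qed
    then show False using \<open>B \<subset> V\<close> by blast
  qed
  show thesis using that A'max 1 2 by blast
qed

end

section \<open>The action on \<open>\<Omega>\<^sub>1(C\<^sub>S(\<XX>(S)))\<close>\<close>

text \<open>Two rounds of passing from generators to the generated group, one for each factor. Lying
  in its own centralizer expresses that a subgroup is abelian.\<close>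

lemma (in group) generate_commuting:
  assumes T: "T \<subseteq> carrier G" and comm: "\<And>s t. s \<in> T \<Longrightarrow> t \<in> T \<Longrightarrow> s \<otimes> t = t \<otimes> s"
  shows "generate G T \<subseteq> centralizer G (generate G T)"
proof -
  have "T \<subseteq> centralizer G T" using T comm by (auto simp: centralizer_def)
  then have "generate G T \<subseteq> centralizer G T"
    by (intro generate_subgroup_incl centralizer_is_subgroup T)
  then have "T \<subseteq> centralizer G (generate G T)" using T by (auto simp: centralizer_def)
  then show ?thesis
    by (intro generate_subgroup_incl centralizer_is_subgroup generate_incl T)
qed

locale finite_odd_p_group = finite_p_group +
  assumes odd: "odd p"
begin

definition \<XX> where "\<XX> = oliver_subgroup G p"
definition V where "V = Omega1 G p (centralizer G \<XX>)"

text \<open>Oddness of \<open>p\<close> enters here: it lets quadratic action satisfy the chain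
  condition.\<close>

lemma two_le: "2 \<le> p - 1"
  using prime_ge_2_nat [OF prime] odd by (cases "p = 2") auto

lemma X_chain: "oliver_chain G p \<XX>" and X_greatest: "oliver_chain G p K \<Longrightarrow> K \<subseteq> \<XX>"
  unfolding \<XX>_def using oliver_subgroup_props [OF finite_carrier] by blast+

lemma X_normal: "\<XX> \<lhd> G" and X_subgroup: "subgroup \<XX> G" and X_carrier: "\<XX> \<subseteq> carrier G"
  using oliver_chain_normal [OF X_chain] by (auto dest: normal_imp_subgroup subgroup.mem_carrier)

lemma X_absorb:
  assumes "R \<lhd> G" "\<XX> \<subseteq> R" "comm_iter G V R (p - 1) = {\<one>}"
  shows "R \<subseteq> \<XX>"
  using X_greatest oliver_chain_extend [OF X_chain] assms unfolding V_def by blast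

lemma centralizer_X_normal: "centralizer G \<XX> \<lhd> G"
  by (rule centralizer_is_normal [OF X_normal])

lemma V_normal: "V \<lhd> G"
  unfolding V_def by (rule Omega1_is_normal [OF centralizer_X_normal])

lemma V_subset_centralizer: "V \<subseteq> centralizer G \<XX>"
  unfolding V_def by (intro Omega1_subset normal_imp_subgroup centralizer_X_normal)

lemma V_carrier: "V \<subseteq> carrier G"
  using V_subset_centralizer by (auto simp: centralizer_def)

lemma one_in_V: "\<one> \<in> V"
  unfolding V_def by (rule one_in_Omega1)

text \<open>Otherwise a nontrivial central element of \<open>S / Z(\<XX>)\<close> in \<open>C(\<XX>) / Z(\<XX>)\<close> yields an abelian
  normal subgroup \<open>D \<le> C(\<XX>)\<close> not contained in \<open>\<XX>\<close>. It acts quadratically on everything, so \<open>\<XX> D\<close>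
  prolongs the chain.\<close>

lemma centralizer_X_subset: "centralizer G \<XX> \<subseteq> \<XX>"
proof (rule ccontr)
  assume not: "\<not> centralizer G \<XX> \<subseteq> \<XX>"
  let ?C = "centralizer G \<XX>"
  define Z where "Z = ?C \<inter> \<XX>"
  have Zn: "Z \<lhd> G" unfolding Z_def by (intro normal_subgroup_intersect centralizer_X_normal X_normal)
  have Zs: "subgroup Z G" by (rule normal_imp_subgroup [OF Zn])
  have Cs: "subgroup ?C G" by (rule normal_imp_subgroup [OF centralizer_X_normal])
  have "Z \<subset> ?C" using not by (auto simp: Z_def)
  obtain n where n: "order G = p ^ n" by (rule order_prime_power)
  obtain g where g: "g \<in> ?C - Z"
      and gZ: "\<And>h. h \<in> carrier G \<Longrightarrow> g \<otimes> h \<otimes> inv g \<otimes> inv h \<in> Z"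
    by (rule normalized_subgroups_central_element [OF prime n subgroup_self Cs Zs \<open>Z \<subset> ?C\<close>])
      (use normal.inv_op_closed2 [OF centralizer_X_normal] normal.inv_op_closed2 [OF Zn] in auto)
  have gc: "g \<in> carrier G" using g by (simp add: centralizer_def)
  have Zc: "z \<in> carrier G" if "z \<in> Z" for z using Zs that by (rule subgroup.mem_carrier)
  have Zcentral: "z \<otimes> y = y \<otimes> z" if "z \<in> Z" "y \<in> ?C" for z y
    using that by (auto simp: Z_def centralizer_def)
  \<comment> \<open>\<open>T\<close> consists of the center \<open>Z\<close> of \<open>\<XX>\<close>
    and one further coset. Since \<open>g\<close> is central modulo \<open>Z\<close>, conjugation
    preserves \<open>T\<close>, so the group generated by \<open>T\<close> is normal.\<close>
  define T where "T = Z \<union> (Z #> g)"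
  have zg: "z \<otimes> g \<in> T" if "z \<in> Z" for z using that by (auto simp: T_def r_coset_def)
  have TC: "T \<subseteq> ?C"
    using g subgroup.m_closed [OF Cs] by (auto simp: T_def Z_def r_coset_def)
  have Tc: "T \<subseteq> carrier G" using TC by (auto simp: centralizer_def)
  have Tcomm: "s \<otimes> t = t \<otimes> s" if s: "s \<in> T" and t: "t \<in> T" for s t
  proof -
    have T: "t \<in> Z \<or> (\<exists>z\<in>Z. t = z \<otimes> g)" if "t \<in> T" for t
      using that by (auto simp: T_def r_coset_def)
    have "z \<otimes> g \<otimes> (z' \<otimes> g) = z' \<otimes> g \<otimes> (z \<otimes> g)" if z: "z \<in> Z" "z' \<in> Z" for z z'
    proof -
      have 1: "u \<otimes> g \<otimes> (u' \<otimes> g) = u \<otimes> u' \<otimes> (g \<otimes> g)" if "u \<in> Z" "u' \<in> Z" for u u'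
      proof -
        have "u \<otimes> g \<otimes> (u' \<otimes> g) = u \<otimes> (g \<otimes> u') \<otimes> g" using that gc Zc by (simp add: m_assoc)
        also have "\<dots> = u \<otimes> (u' \<otimes> g) \<otimes> g" using Zcentral [OF that(2)] g by simp
        finally show ?thesis using that gc Zc by (simp add: m_assoc)
      qed
      have "z \<otimes> z' = z' \<otimes> z" using z by (intro Zcentral) (auto simp: Z_def)
      then show ?thesis using 1 z by simp
    qed
    then show ?thesis using T [OF s] T [OF t] Zcentral s t TC by (metis subsetD)
  qed
  define D where "D = generate G T"
  have TD: "T \<subseteq> D" by (auto simp: D_def intro: generate.incl)
  have Dabelian: "D \<subseteq> centralizer G D" unfolding D_def by (rule generate_commuting [OF Tc Tcomm])
  have Dn: "D \<lhd> G"
    unfolding D_def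
  proof (rule normal_generateI [OF Tc])
    fix t h assume t: "t \<in> T" and h: "h \<in> carrier G"
    show "h \<otimes> t \<otimes> inv h \<in> T"
    proof (cases "t \<in> Z")
      case True
      then show ?thesis using normal.inv_op_closed2 [OF Zn h] by (simp add: T_def)
    next
      case False
      then obtain z where z: "z \<in> Z" "t = z \<otimes> g" using t by (auto simp: T_def r_coset_def)
      let ?k = "g \<otimes> h \<otimes> inv g \<otimes> inv h"
      have "h \<otimes> t \<otimes> inv h = (h \<otimes> z \<otimes> inv h) \<otimes> inv ?k \<otimes> g"
        using z h gc Zc by (simp add: group_cancel)
      moreover have "(h \<otimes> z \<otimes> inv h) \<otimes> inv ?k \<in> Z"
        by (rule subgroup.m_closed [OF Zs normal.inv_op_closed2 [OF Zn h z(1)]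
              subgroup.m_inv_closed [OF Zs gZ [OF h]]])
      ultimately show ?thesis using zg by simp
    qed
  qed
  have Ds: "subgroup D G" by (rule normal_imp_subgroup [OF Dn])
  have Dc: "D \<subseteq> carrier G" by (rule subgroup.subset [OF Ds])
  have 1: "commutator_subgroup G V D \<subseteq> D"
  proof (rule commutator_subgroup_subset [OF Ds])
    fix a d assume a: "a \<in> V" and d: "d \<in> D"
    have "a \<otimes> d \<otimes> inv a \<in> D" using normal.inv_op_closed2 [OF Dn _ d] a V_carrier by blast
    then show "a \<otimes> d \<otimes> inv a \<otimes> inv d \<in> D"
      using d by (rule subgroup.m_closed [OF Ds _ subgroup.m_inv_closed [OF Ds]])
  qed
  have "commutator_subgroup G (commutator_subgroup G V D) D \<subseteq> {\<one>}"
  proof (rule commutator_subgroup_subset [OF triv_subgroup])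
    fix a d assume a: "a \<in> commutator_subgroup G V D" and d: "d \<in> D"
    have "a \<in> D" using a 1 by blast
    then have "a \<otimes> d = d \<otimes> a" "a \<in> carrier G" "d \<in> carrier G"
      using d Dabelian Dc by (auto simp: centralizer_def)
    then show "a \<otimes> d \<otimes> inv a \<otimes> inv d \<in> {\<one>}" by (simp add: group_cancel)
  qed
  then have "comm_iter G V D 2 = {\<one>}"
    using one_in_comm_iter [OF one_in_V, of D 2] by (auto simp: numeral_2_eq_2)
  then have "comm_iter G V D (p - 1) = {\<one>}"
    by (rule comm_iter_trivial_mono [OF Dc _ two_le])
  \<comment> \<open>\<open>V\<close> centralizes \<open>\<XX>\<close>, so the factor
    \<open>\<XX>\<close> contributes nothing to the iterated commutators.\<close>
  then have "comm_iter G V (\<XX> <#> D) (p - 1) \<subseteq> {\<one>}"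
    using comm_iter_set_mult_centralized [OF X_normal Dn V_subset_centralizer, of "p - 1"] by simp
  then have "comm_iter G V (\<XX> <#> D) (p - 1) = {\<one>}"
    using one_in_comm_iter [OF one_in_V] by blast
  moreover have "\<XX> \<subseteq> \<XX> <#> D" "D \<subseteq> \<XX> <#> D"
    using X_subgroup Ds X_carrier Dc
    by (simp_all add: subset_set_mult_left subset_set_mult_right subgroup.one_closed)
  ultimately have "D \<subseteq> \<XX>" using X_absorb [OF normal_set_mult [OF X_normal Dn]] by blast
  moreover have "g \<in> D" using zg [OF subgroup.one_closed [OF Zs]] gc TD by auto
  ultimately show False using g by (auto simp: Z_def)
qed

text \<open>By \<open>centralizer_X_subset\<close> the centralizer of \<open>\<XX>\<close> is
  abelian. Its elements killed by \<open>p\<close> therefore form a subgroup, which contains the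
  generators of \<open>V\<close>.\<close>

lemma V_elementary_abelian: "elementary_abelian G p V"
proof -
  let ?C = "centralizer G \<XX>"
  have Cs: "subgroup ?C G" by (rule normal_imp_subgroup [OF centralizer_X_normal])
  have comm: "x \<otimes> y = y \<otimes> x" if "x \<in> ?C" "y \<in> ?C" for x y
    using that centralizer_X_subset by (auto simp: centralizer_def)
  have Cc: "x \<in> carrier G" if "x \<in> ?C" for x using Cs that by (rule subgroup.mem_carrier)
  have "subgroup {x \<in> ?C. x [^] p = \<one>} G"
  proof (rule subgroupI)
    show "{x \<in> ?C. x [^] p = \<one>} \<noteq> {}" using subgroup.one_closed [OF Cs] nat_pow_one by blast
  qed (use Cs Cc comm in \<open>auto simp: nat_pow_inv pow_mult_distrib subgroup.m_closed subgroup.m_inv_closed\<close>)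
  then have "V \<subseteq> {x \<in> ?C. x [^] p = \<one>}"
    unfolding V_def Omega1_def using Cc by (intro generate_subgroup_incl) (auto simp: pow_eq_id)
  then show ?thesis
    using normal_imp_subgroup [OF V_normal] comm by (auto simp: elementary_abelian_def)
qed

text \<open>The commutator of \<open>V\<close> with its centralizer is already trivial, so the
  centralizer may be appended to a chain ending in \<open>\<XX>\<close> and is absorbed. This lets
  \<open>\<XX>\<close> be recognized by its action on \<open>V\<close>.\<close>

lemma X_eq_centralizer_V: "\<XX> = centralizer G V"
proof
  show 1: "\<XX> \<subseteq> centralizer G V"
    using V_subset_centralizer X_carrier by (auto simp: centralizer_def)
  let ?R = "centralizer G V"
  have Rn: "?R \<lhd> G" by (rule centralizer_is_normal [OF V_normal])
  have Rc: "?R \<subseteq> carrier G" by (auto simp: centralizer_def)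
  have "commutator_subgroup G V ?R \<subseteq> {\<one>}"
  proof (rule commutator_subgroup_subset [OF triv_subgroup])
    fix v r assume "v \<in> V" "r \<in> ?R"
    then have "v \<otimes> r = r \<otimes> v" "v \<in> carrier G" "r \<in> carrier G"
      using V_carrier by (auto simp: centralizer_def)
    then show "v \<otimes> r \<otimes> inv v \<otimes> inv r \<in> {\<one>}" by (simp add: group_cancel)
  qed
  then have "comm_iter G V ?R 1 = {\<one>}"
    using one_in_comm_iter [OF one_in_V, of ?R 1] by auto
  then have "comm_iter G V ?R (p - 1) = {\<one>}"
    by (rule comm_iter_trivial_mono [OF Rc]) (use two_le in simp)
  then show "?R \<subseteq> \<XX>" by (rule X_absorb [OF Rn 1])
qed

section \<open>Quadratic action of elementary abelian subgroups on \<open>V\<close>\<close>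

lemma quadratic_maximal_elementary_abelian:
  assumes "maximal_elementary_abelian E" "\<not> E \<subseteq> \<XX>"
  obtains A where "maximal_elementary_abelian A" "\<not> A \<subseteq> \<XX>"
    "\<And>v a. v \<in> V \<Longrightarrow> a \<in> A \<Longrightarrow> v \<otimes> a \<otimes> inv v \<otimes> inv a \<in> centralizer G A"
proof -
  let ?P = "\<lambda>A. maximal_elementary_abelian A \<and> \<not> A \<subseteq> \<XX>"
  have finV: "finite V" using V_carrier finite_carrier finite_subset by blast
  have "card (A \<inter> V) < Suc (card V)" for A
    using card_mono [OF finV, of "A \<inter> V"] by simp
  \<comment> \<open>Extremal choice: if \<open>A\<close> did not act quadratically, replacement
    would produce a competitor with larger intersection with \<open>V\<close>, still outside
    \<open>\<XX> = centralizer G V\<close>.\<close>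
  then have "\<exists>A. ?P A \<and> (\<forall>A'. ?P A' \<longrightarrow> card (A' \<inter> V) \<le> card (A \<inter> V))"
    using assms by (intro ex_has_greatest_nat [of ?P E _ "Suc (card V)"]) simp_all
  then obtain A where A: "?P A" and max: "\<And>A'. ?P A' \<Longrightarrow> card (A' \<inter> V) \<le> card (A \<inter> V)"
    by (elim exE conjE) simp
  have "\<forall>v\<in>V. \<forall>a\<in>A. v \<otimes> a \<otimes> inv v \<otimes> inv a \<in> centralizer G A"
  proof (rule ccontr)
    assume not: "\<not> ?thesis"
    obtain A' where A': "maximal_elementary_abelian A'" "A \<inter> V \<subset> A' \<inter> V" "\<not> A' \<subseteq> centralizer G V"
      using thompson_replacement [OF conjunct1 [OF A] V_elementary_abelian V_normal not] .
    have "card (A \<inter> V) < card (A' \<inter> V)" using A'(2) finV by (intro psubset_card_mono) auto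
    moreover have "?P A'" using A' X_eq_centralizer_V by simp
    ultimately show False using max by (meson not_le)
  qed
  then show thesis using that A by blast
qed

text \<open>As \<open>\<XX>\<close> centralizes \<open>V\<close>, commutators of \<open>V\<close>
  with \<open>a \<otimes> x\<close> reduce to those with \<open>a\<close>. The first step lands in
  the elements of \<open>V\<close> fixed by \<open>A\<close>, and the second kills them.\<close>

lemma comm_iter_V_quadratic:
  assumes A: "subgroup A G"
    and quadratic: "\<And>v a. v \<in> V \<Longrightarrow> a \<in> A \<Longrightarrow> v \<otimes> a \<otimes> inv v \<otimes> inv a \<in> centralizer G A"
  shows "comm_iter G V (A <#> \<XX>) (p - 1) = {\<one>}"
proof -
  let ?L = "A <#> \<XX>" and ?W = "V \<inter> centralizer G A"
  have Ac: "A \<subseteq> carrier G" by (rule subgroup.subset [OF A])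
  have Lc: "?L \<subseteq> carrier G" using Ac X_carrier by (rule setmult_subset_G)
  have Vs: "subgroup V G" by (rule normal_imp_subgroup [OF V_normal])
  have Ws: "subgroup ?W G" by (intro subgroups_Inter_pair Vs centralizer_is_subgroup Ac)
  have comm: "v \<otimes> (a \<otimes> x) \<otimes> inv v \<otimes> inv (a \<otimes> x) = v \<otimes> a \<otimes> inv v \<otimes> inv a"
    if "v \<in> V" "a \<in> A" "x \<in> \<XX>" for v a x
  proof -
    have c: "v \<in> carrier G" "a \<in> carrier G" "x \<in> carrier G" using that V_carrier Ac X_carrier by auto
    have "inv v \<in> V" using Vs that by (simp add: subgroup.m_inv_closed)
    then have vx: "x \<otimes> inv v = inv v \<otimes> x"
      using that V_subset_centralizer by (auto simp: centralizer_def)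
    have "v \<otimes> (a \<otimes> x) \<otimes> inv v \<otimes> inv (a \<otimes> x) = v \<otimes> a \<otimes> (x \<otimes> inv v) \<otimes> inv x \<otimes> inv a"
      using c by (simp add: group_cancel)
    also have "\<dots> = v \<otimes> a \<otimes> inv v \<otimes> inv a" unfolding vx using c by (simp add: group_cancel)
    finally show ?thesis .
  qed
  have 1: "commutator_subgroup G V ?L \<subseteq> ?W"
  proof (rule commutator_subgroup_subset [OF Ws])
    fix v l assume v: "v \<in> V" and "l \<in> ?L"
    then obtain a x where l: "a \<in> A" "x \<in> \<XX>" "l = a \<otimes> x" by (auto simp: set_mult_def)
    have c: "v \<in> carrier G" "a \<in> carrier G" using v l V_carrier Ac by auto
    have "a \<otimes> inv v \<otimes> inv a \<in> V"
      by (rule normal.inv_op_closed2 [OF V_normal c(2) subgroup.m_inv_closed [OF Vs v]])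
    then have "v \<otimes> (a \<otimes> inv v \<otimes> inv a) \<in> V" by (rule subgroup.m_closed [OF Vs v])
    then have "v \<otimes> a \<otimes> inv v \<otimes> inv a \<in> ?W" using quadratic [OF v l(1)] c by (simp add: m_assoc)
    then show "v \<otimes> l \<otimes> inv v \<otimes> inv l \<in> ?W" using comm v l by simp
  qed
  have "commutator_subgroup G (commutator_subgroup G V ?L) ?L \<subseteq> {\<one>}"
  proof (rule commutator_subgroup_subset [OF triv_subgroup])
    fix u l assume "u \<in> commutator_subgroup G V ?L" "l \<in> ?L"
    then obtain a x where u: "u \<in> ?W" and l: "a \<in> A" "x \<in> \<XX>" "l = a \<otimes> x"
      using 1 by (auto simp: set_mult_def)
    have "u \<otimes> a = a \<otimes> u" "u \<in> carrier G" "a \<in> carrier G"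
      using u l Ac by (auto simp: centralizer_def)
    then have "u \<otimes> a \<otimes> inv u \<otimes> inv a = \<one>" by (simp add: group_cancel)
    then show "u \<otimes> l \<otimes> inv u \<otimes> inv l \<in> {\<one>}" using comm u l by simp
  qed
  then have "comm_iter G V ?L 2 = {\<one>}"
    using one_in_comm_iter [OF one_in_V, of ?L 2] by (auto simp: numeral_2_eq_2)
  then show ?thesis by (rule comm_iter_trivial_mono [OF Lc _ two_le])
qed

section \<open>Oliver subgroups of groups between \<open>\<XX>\<close> and
  \<open>thompson_subgroup G p <#> \<XX>\<close>\<close>

lemma oliver_subgroup_quadratic_extension:
  assumes A: "subgroup A G"
    and quadratic: "\<And>v a. v \<in> V \<Longrightarrow> a \<in> A \<Longrightarrow> v \<otimes> a \<otimes> inv v \<otimes> inv a \<in> centralizer G A"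
  shows "A <#> \<XX> \<subseteq> oliver_subgroup (G\<lparr>carrier := A <#> \<XX>\<rparr>) p"
proof -
  let ?L = "A <#> \<XX>"
  have L: "subgroup ?L G" by (rule subgroup_set_mult_normal [OF A X_normal])
  interpret L: group "G\<lparr>carrier := ?L\<rparr>" by (rule subgroup_imp_group [OF L])
  have XL: "\<XX> \<subseteq> ?L" using X_carrier A by (simp add: subset_set_mult_right subgroup.one_closed)
  \<comment> \<open>The chain of \<open>\<XX>\<close> restricts to \<open>?L\<close>, and quadratic
    action allows the whole group \<open>?L\<close> as one further term.\<close>
  have "oliver_chain (G\<lparr>carrier := ?L\<rparr>) p ?L"
  proof (rule L.oliver_chain_extend [OF oliver_chain_restrict [OF L X_chain XL] _ XL])
    show "?L \<lhd> G\<lparr>carrier := ?L\<rparr>" using L.normal_self by simp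
    have "comm_iter G (Omega1 G p (centralizer G \<XX>)) ?L (p - 1) = {\<one>}"
      using comm_iter_V_quadratic [OF assms] by (simp add: V_def)
    from comm_iter_Omega1_centralizer_consistent [OF L order_refl this]
    show "comm_iter (G\<lparr>carrier := ?L\<rparr>) (Omega1 (G\<lparr>carrier := ?L\<rparr>) p
        (centralizer (G\<lparr>carrier := ?L\<rparr>) \<XX>)) ?L (p - 1) = {\<one>\<^bsub>G\<lparr>carrier := ?L\<rparr>\<^esub>}" by simp
  qed
  then show ?thesis using L.oliver_subgroup_props(2) finite_subgroup [OF L] by simp
qed

text \<open>A chain ending in \<open>\<XX>\<close> runs inside \<open>\<XX>\<close>, so it is also a
  chain of the group \<open>\<XX>\<close>, where no larger end is possible.\<close>

lemma oliver_subgroup_idem: "oliver_subgroup (G\<lparr>carrier := \<XX>\<rparr>) p = \<XX>"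
proof -
  interpret L: group "G\<lparr>carrier := \<XX>\<rparr>" by (rule subgroup_imp_group [OF X_subgroup])
  have fin: "finite (carrier (G\<lparr>carrier := \<XX>\<rparr>))" using finite_subgroup [OF X_subgroup] by simp
  have "\<XX> \<subseteq> oliver_subgroup (G\<lparr>carrier := \<XX>\<rparr>) p"
    by (intro L.oliver_subgroup_props(2) [OF fin] oliver_chain_restrict [OF X_subgroup X_chain] order_refl)
  moreover have "oliver_subgroup (G\<lparr>carrier := \<XX>\<rparr>) p \<subseteq> \<XX>"
    using subgroup.subset [OF normal_imp_subgroup [OF L.oliver_chain_normal
          [OF L.oliver_subgroup_props(1) [OF fin]]]] by simp
  ultimately show ?thesis by blast
qed

lemma thompson_subset_oliver_iff:
  "thompson_subgroup G p \<subseteq> \<XX> \<longleftrightarrow>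
    (\<forall>L. subgroup L G \<and> \<XX> \<subseteq> L \<and> L \<subseteq> thompson_subgroup G p <#> \<XX> \<longrightarrow>
      oliver_subgroup (G\<lparr>carrier := L\<rparr>) p = \<XX>)" (is "?J \<subseteq> \<XX> \<longleftrightarrow> ?R")
proof
  assume J: "?J \<subseteq> \<XX>"
  \<comment> \<open>The bounds on \<open>L\<close> collapse, leaving only
    \<open>L = \<XX>\<close>.\<close>
  have "?J <#> \<XX> \<subseteq> \<XX>" using J subgroup.m_closed [OF X_subgroup] by (auto simp: set_mult_def)
  then show ?R using oliver_subgroup_idem by (metis subset_antisym subset_trans)
next
  assume R: ?R
  show "?J \<subseteq> \<XX>"
  proof (rule ccontr)
    assume "\<not> ?J \<subseteq> \<XX>"
    then have "\<not> \<Union>{E. maximal_elementary_abelian E} \<subseteq> \<XX>"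
      unfolding thompson_subgroup_def maximal_elementary_abelian_def
      using generate_subgroup_incl [OF _ X_subgroup] by blast
    then obtain E where E: "maximal_elementary_abelian E" "\<not> E \<subseteq> \<XX>" by blast
    obtain A where A: "maximal_elementary_abelian A" "\<not> A \<subseteq> \<XX>"
        "\<And>v a. v \<in> V \<Longrightarrow> a \<in> A \<Longrightarrow> v \<otimes> a \<otimes> inv v \<otimes> inv a \<in> centralizer G A"
      using quadratic_maximal_elementary_abelian [OF E] by blast
    have As: "subgroup A G"
      using A(1) by (simp add: maximal_elementary_abelian_def elementary_abelian_def)
    have incl: "A \<subseteq> A <#> \<XX>" "\<XX> \<subseteq> A <#> \<XX>"
      using As X_subgroup
      by (simp_all add: subset_set_mult_left subset_set_mult_right subgroup.subset subgroup.one_closed)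
    have "A \<subseteq> ?J"
      unfolding thompson_subgroup_def using A(1)
      by (auto simp: maximal_elementary_abelian_def intro!: generate.incl)
    then have "A <#> \<XX> \<subseteq> ?J <#> \<XX>" by (intro mono_set_mult order_refl)
    \<comment> \<open>The hypothesis is tested on \<open>L = A <#> \<XX>\<close>, which is contained
      in its own Oliver subgroup; equality with \<open>\<XX>\<close> would put \<open>A\<close>
      inside \<open>\<XX>\<close>.\<close>
    then have "oliver_subgroup (G\<lparr>carrier := A <#> \<XX>\<rparr>) p = \<XX>"
      using R incl(2) subgroup_set_mult_normal [OF As X_normal] by blast
    then show False using oliver_subgroup_quadratic_extension [OF As A(3)] incl(1) A(2) by blast
  qed
qed

end

theorem theorem1p4:
  fixes S :: "('a, 'b) monoid_scheme" and p :: nat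
  assumes "p_group S p" and "odd p"
  shows "thompson_subgroup S p \<subseteq> oliver_subgroup S p \<longleftrightarrow>
         (\<forall>L. subgroup L S \<and> oliver_subgroup S p \<subseteq> L \<and>
              L \<subseteq> thompson_subgroup S p <#>\<^bsub>S\<^esub> oliver_subgroup S p \<longrightarrow>
              oliver_subgroup (S\<lparr>carrier := L\<rparr>) p = oliver_subgroup S p)"
proof -
  interpret group S using assms(1) by (simp add: p_group_def)
  interpret finite_odd_p_group S p by unfold_locales (fact assms)+
  show ?thesis using thompson_subset_oliver_iff unfolding \<XX>_def .
qed

end
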